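(* Let $J$ satisfy (A1)--(A3), let $(\mathcal E,\mathcal F)$ be the associated Dirichlet form and, for $\xi>0$, let $(\mathcal E^{(\xi)},\mathcal F^{(\xi)})$ be the Dirichlet form associated with the kernel $J_\xi$ (all as in the context). Then, as $\xi\to 0+$, $(\mathcal E^{(\xi)},\mathcal F^{(\xi)})$ converges to $(\mathcal E,\mathcal F)$ in the sense of Mosco; that is, for every sequence $\xi_n>0$ with $\xi_n\to0$, the sequence $(\mathcal E^{(\xi_n)},\mathcal F^{(\xi_n)})$ converges to $(\mathcal E,\mathcal F)$ in the sense of Mosco.
   Context: Let $d\ge 1$ and let $J:\mathbb R^d\times\mathbb R^d\to[0,\infty)$ be measurable with: (A1) $J(x,y)=J(y,x)$ for all $x,y$; (A2) $J(x,y)=0$ for $|x-y|\ge 1$; (A3) there exist $0<\alpha<\beta<2$ and $\kappa_1,\kappa_2>0$ such that $\kappa_1|y-x|^{-d-\alpha}\le J(x,y)\le \kappa_2|y-x|^{-d-\beta}$ for $0<|x-y|<1$. Set $\mathcal E(f,f)=\int_{\mathbb R^d}\int_{\mathbb R^d}(f(y)-f(x))^2J(x,y)\,dx\,dy$, $\mathcal E_1(f,f)=\mathcal E(f,f)+\|f\|_2^2$, and let $\mathcal F$ be the closure of $C^1_c(\mathbb R^d)$ with respect to the norm $\mathcal E_1(f,f)^{1/2}$. For $\xi>0$ put $$J_\xi(x,y)=J(x,y)\mathbf 1_{(|x-y|>\xi)}+\kappa_2|x-y|^{-d-\beta}\mathbf 1_{(|x-y|\le\xi)},$$ and define $(\mathcal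 E^{(\xi)},\mathcal F^{(\xi)})$ in the same way as $(\mathcal E,\mathcal F)$ with $J_\xi$ in place of $J$. Mosco convergence: extend quadratic forms to all of $L^2$ by the value $+\infty$ outside their domain. A sequence of closed quadratic forms $(\mathcal E^n,\mathcal F^n)$ on $L^2$ converges to a closed form $(\mathcal E,\mathcal F)$ in the sense of Mosco if (a) for every sequence $u_n$ converging weakly to $u$ in $L^2$, $\liminf_n\mathcal E^n(u_n,u_n)\ge\mathcal E(u,u)$; and (b) for every $u\in L^2$ there is a sequence $u_n$ converging strongly to $u$ in $L^2$ with $\limsup_n\mathcal E^n(u_n,u_n)\le\mathcal E(u,u)$. *)

theory Defs
  imports "HOL-Analysis.Analysis"
begin

text \<open>Square-integrable functions, as representatives of their almost-everywhere classes.
  The convergence notions, forms and form domains below depend only on these classes.\<close>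

definition L2 :: "('a::euclidean_space \<Rightarrow> real) set" where
  "L2 = {f. f \<in> borel_measurable lebesgue \<and> integrable lebesgue (\<lambda>x. (f x)\<^sup>2)}"

definition L2_strong_conv ::
    "(nat \<Rightarrow> 'a::euclidean_space \<Rightarrow> real) \<Rightarrow> ('a \<Rightarrow> real) \<Rightarrow> bool" where
  "L2_strong_conv us u \<longleftrightarrow> (\<forall>n. us n \<in> L2) \<and> u \<in> L2 \<and>
     (\<lambda>n. \<integral>x. (us n x - u x)\<^sup>2 \<partial>lebesgue) \<longlonglongrightarrow> 0"

definition L2_weak_conv ::
    "(nat \<Rightarrow> 'a::euclidean_space \<Rightarrow> real) \<Rightarrow> ('a \<Rightarrow> real) \<Rightarrow> bool" where
  "L2_weak_conv us u \<longleftrightarrow> (\<forall>n. us n \<in> L2) \<and> u \<in> L2 \<and>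
     (\<forall>v\<in>L2. (\<lambda>n. \<integral>x. us n x * v x \<partial>lebesgue) \<longlonglongrightarrow> (\<integral>x. u x * v x \<partial>lebesgue))"

definition C1_compact_support :: "('a::euclidean_space \<Rightarrow> real) set" where
  "C1_compact_support = {f.
     (\<exists>f' :: 'a \<Rightarrow> 'a \<Rightarrow>\<^sub>L real.
        (\<forall>x. (f has_derivative blinfun_apply (f' x)) (at x)) \<and> continuous_on UNIV f') \<and>
     compact (closure {x. f x \<noteq> 0})}"

text \<open>The diagonal value \<^term>\<open>form J f\<close> stands for \<open>\<E>(f,f)\<close>; it may be infinite.
  The double integral is taken with respect to Lebesgue measure on the product space.\<close>

definition form :: "('a::euclidean_space \<Rightarrow> 'a \<Rightarrow> real) \<Rightarrow> ('a \<Rightarrow> real) \<Rightarrow> ennreal" where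
  "form J f = (\<integral>\<^sup>+ z. ennreal ((f (snd z) - f (fst z))\<^sup>2 * J (fst z) (snd z)) \<partial>lebesgue)"

definition form1 :: "('a::euclidean_space \<Rightarrow> 'a \<Rightarrow> real) \<Rightarrow> ('a \<Rightarrow> real) \<Rightarrow> ennreal" where
  "form1 J f = form J f + (\<integral>\<^sup>+ x. ennreal ((f x)\<^sup>2) \<partial>lebesgue)"

text \<open>The (sequential) closure of \<open>C\<^sup>1\<^sub>c\<close> in \<open>L\<^sup>2\<close> with respect to the norm
  \<open>\<E>\<^sub>1(f,f)\<^sup>1\<^sup>/\<^sup>2\<close>.\<close>

definition form_domain ::
    "('a::euclidean_space \<Rightarrow> 'a \<Rightarrow> real) \<Rightarrow> ('a \<Rightarrow> real) set" where
  "form_domain J = {f \<in> L2. \<exists>g :: nat \<Rightarrow> 'a \<Rightarrow> real.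
     (\<forall>n. g n \<in> C1_compact_support) \<and> (\<lambda>n. form1 J (\<lambda>x. f x - g n x)) \<longlonglongrightarrow> 0}"

text \<open>On the diagonal the second branch evaluates to \<open>0\<close> (since \<open>0 powr a = 0\<close>); there the
  integrand of \<^const>\<open>form\<close> vanishes anyway.\<close>

definition J_xi ::
    "real \<Rightarrow> real \<Rightarrow> ('a::euclidean_space \<Rightarrow> 'a \<Rightarrow> real) \<Rightarrow> real \<Rightarrow> 'a \<Rightarrow> 'a \<Rightarrow> real" where
  "J_xi \<kappa>\<^sub>2 \<beta> J \<xi> x y =
     (if norm (x - y) > \<xi> then J x y
      else \<kappa>\<^sub>2 * norm (x - y) powr (- real DIM('a) - \<beta>))"

definition extended_form ::
    "(('a::euclidean_space \<Rightarrow> real) \<Rightarrow> ennreal) \<Rightarrow> ('a \<Rightarrow> real) set \<Rightarrow> ('a \<Rightarrow> real) \<Rightarrow> ennreal" where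
  "extended_form E F u = (if u \<in> F then E u else \<infinity>)"

definition mosco_converges ::
    "(nat \<Rightarrow> ('a::euclidean_space \<Rightarrow> real) \<Rightarrow> ennreal) \<Rightarrow> (nat \<Rightarrow> ('a \<Rightarrow> real) set) \<Rightarrow>
     (('a \<Rightarrow> real) \<Rightarrow> ennreal) \<Rightarrow> ('a \<Rightarrow> real) set \<Rightarrow> bool" where
  "mosco_converges En Fn E F \<longleftrightarrow>
     (\<forall>us u. L2_weak_conv us u \<longrightarrow>
        extended_form E F u \<le> liminf (\<lambda>n. extended_form (En n) (Fn n) (us n))) \<and>
     (\<forall>u\<in>L2. \<exists>us. L2_strong_conv us u \<and>
        limsup (\<lambda>n. extended_form (En n) (Fn n) (us n)) \<le> extended_form E F u)"

end

theory Submission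
  imports Defs
begin

text \<open>Off the diagonal \<open>J \<le> J\<^sub>\<xi>\<close>, because \<open>\<kappa>\<^sub>2 \<bar>x - y\<bar>\<^bsup>- d - \<beta>\<^esup>\<close> is the upper bound for \<open>J\<close>, and on the
  diagonal increments vanish. Hence \<open>\<E> \<le> \<E>\<^bsup>(\<xi>)\<^esup>\<close> and \<open>\<F>\<^bsup>(\<xi>)\<^esup> \<subseteq> \<F>\<close>, both domains being closures of the
  same core. So every extended form \<open>\<E>\<^bsup>(\<xi>)\<^esup>\<close> lies above \<open>\<E>\<close>, and the two halves of Mosco convergence
  become unequal in kind: a property of \<open>\<E>\<close> alone, and an estimate on the core.

  For the lower bound it is enough that the single extended form \<open>\<E>\<close> is weakly lower
  semicontinuous (\<open>form_weakly_lower_semicontinuous\<close>), which is the Hilbert space fact that a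
  closed form is. The form is the squared norm of the increment \<open>f y - f x\<close> in \<open>L\<^sup>2\<close> of the measure
  \<open>J dx dy\<close>, so everything follows from geometry in \<open>L\<^sup>2\<close> spaces. The parallelogram law makes
  minimizing sequences Cauchy (\<open>minimizing_sequence_Cauchy\<close>). Used for the distance to a
  point, this gives Mazur's theorem (\<open>mazur_square_integrable\<close>); used for the form on shrinking
  neighbourhoods of the weak limit, it gives approximants that are Cauchy for the form, and
  Fatou's lemma identifies their limit.

  For the recovery sequence only functions in the core matter. They are Lipschitz
  with compact support and \<open>\<beta> < 2\<close>, so jumps of length at most \<open>\<xi>\<close> contribute an energy of order
  at most \<open>\<xi>\<^bsup>(2 - \<beta>) / 2\<^esup>\<close> (\<open>form_J_xi_le\<close>). For \<open>u\<close> in the domain one approximates by the core and lets the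
  approximation improve slowly with \<open>n\<close> (\<open>diagonal_index\<close>); where the extended form is infinite,
  the constant sequence \<open>u\<close> works.\<close>

section \<open>Square-integrable functions\<close>

definition square_integrable :: "'b measure \<Rightarrow> ('b \<Rightarrow> real) set" where
  "square_integrable M = {f \<in> borel_measurable M. integrable M (\<lambda>x. (f x)\<^sup>2)}"

lemma square_integrableD:
  assumes "f \<in> square_integrable M"
  shows "f \<in> borel_measurable M" "integrable M (\<lambda>x. (f x)\<^sup>2)"
  using assms by (auto simp: square_integrable_def)

lemma square_integrable_add:
  assumes "f \<in> square_integrable M" "g \<in> square_integrable M"
  shows "(\<lambda>x. f x + g x) \<in> square_integrable M"
proof -
  note [measurable] = square_integrableD(1)[OF assms(1)] square_integrableD(1)[OF assms(2)]
  have "integrable M (\<lambda>x. 2 * (f x)\<^sup>2 + 2 * (g x)\<^sup>2)"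
    using assms by (auto simp: square_integrable_def)
  then have "integrable M (\<lambda>x. (f x + g x)\<^sup>2)"
  proof (rule Bochner_Integration.integrable_bound)
    show "AE x in M. norm ((f x + g x)\<^sup>2) \<le> norm (2 * (f x)\<^sup>2 + 2 * (g x)\<^sup>2)"
    proof (rule AE_I2)
      fix x
      have "(f x + g x)\<^sup>2 \<le> 2 * (f x)\<^sup>2 + 2 * (g x)\<^sup>2"
        using sum_squares_bound[of "f x" "g x"] by (simp add: power2_sum)
      then show "norm ((f x + g x)\<^sup>2) \<le> norm (2 * (f x)\<^sup>2 + 2 * (g x)\<^sup>2)" by simp
    qed
  qed measurable
  then show ?thesis by (simp add: square_integrable_def)
qed

lemma square_integrable_scale:
  assumes "f \<in> square_integrable M"
  shows "(\<lambda>x. c * f x) \<in> square_integrable M"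
  using assms by (auto simp: square_integrable_def power_mult_distrib)

lemma square_integrable_diff:
  assumes "f \<in> square_integrable M" "g \<in> square_integrable M"
  shows "(\<lambda>x. f x - g x) \<in> square_integrable M"
  using square_integrable_add[OF assms(1) square_integrable_scale[OF assms(2), of "-1"]] by simp

lemma square_integrable_mult:
  assumes "f \<in> square_integrable M" "g \<in> square_integrable M"
  shows "integrable M (\<lambda>x. f x * g x)"
proof -
  have "integrable M (\<lambda>x. (f x + g x)\<^sup>2 - (f x)\<^sup>2 - (g x)\<^sup>2)"
    using square_integrable_add[OF assms] assms by (auto simp: square_integrable_def)
  also have "(\<lambda>x. (f x + g x)\<^sup>2 - (f x)\<^sup>2 - (g x)\<^sup>2) = (\<lambda>x. 2 * (f x * g x))"
    by (auto simp: power2_eq_square algebra_simps)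
  finally show ?thesis by simp
qed

lemma nn_integral_square_eq:
  assumes "f \<in> square_integrable M"
  shows "(\<integral>\<^sup>+ x. ennreal ((f x)\<^sup>2) \<partial>M) = ennreal (\<integral>x. (f x)\<^sup>2 \<partial>M)"
  using assms by (intro nn_integral_eq_integral) (auto simp: square_integrable_def)

lemma square_integrable_iff_finite:
  assumes "f \<in> borel_measurable M"
  shows "f \<in> square_integrable M \<longleftrightarrow> (\<integral>\<^sup>+ x. ennreal ((f x)\<^sup>2) \<partial>M) < \<infinity>"
  using assms by (auto simp: square_integrable_def integrable_iff_bounded)

lemma integral_parallelogram_midpoint:
  assumes "f \<in> square_integrable M" "g \<in> square_integrable M"
  shows "(\<integral>x. (f x - g x)\<^sup>2 \<partial>M) + 4 * (\<integral>x. ((f x + g x) / 2)\<^sup>2 \<partial>M) =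
    2 * (\<integral>x. (f x)\<^sup>2 \<partial>M) + 2 * (\<integral>x. (g x)\<^sup>2 \<partial>M)"
proof -
  have *: "integrable M (\<lambda>x. (f x - g x)\<^sup>2)" "integrable M (\<lambda>x. (f x + g x)\<^sup>2)"
    "integrable M (\<lambda>x. (f x)\<^sup>2)" "integrable M (\<lambda>x. (g x)\<^sup>2)"
    using square_integrable_diff[OF assms] square_integrable_add[OF assms] assms
    by (auto simp: square_integrable_def)
  have "(\<integral>x. (f x - g x)\<^sup>2 \<partial>M) + 4 * (\<integral>x. ((f x + g x) / 2)\<^sup>2 \<partial>M) =
      (\<integral>x. (f x - g x)\<^sup>2 + (f x + g x)\<^sup>2 \<partial>M)"
    using * by (simp add: power_divide)
  also have "\<dots> = (\<integral>x. 2 * (f x)\<^sup>2 + 2 * (g x)\<^sup>2 \<partial>M)"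
    by (intro Bochner_Integration.integral_cong) (auto simp: power2_eq_square algebra_simps)
  finally show ?thesis using * by simp
qed

text \<open>The difference of the two sides is the square \<open>(e * b - (a - b))\<^sup>2 / e\<close>. Unlike the triangle
  inequality for norms, this pointwise estimate can be integrated without knowing that the
  integrals are finite.\<close>

lemma square_le_weighted:
  fixes a b e :: real
  assumes "0 < e"
  shows "a\<^sup>2 \<le> (1 + e) * b\<^sup>2 + (1 + 1 / e) * (a - b)\<^sup>2"
proof -
  have "(1 + e) * b\<^sup>2 + (1 + 1 / e) * (a - b)\<^sup>2 - a\<^sup>2 = (e * b - (a - b))\<^sup>2 / e"
    using assms by (simp add: power2_eq_square field_simps)
  moreover have "0 \<le> (e * b - (a - b))\<^sup>2 / e" using assms by simp
  ultimately show ?thesis by linarith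
qed

lemma integral_square_le_weighted:
  assumes "f \<in> square_integrable M" "g \<in> square_integrable M" "0 < e"
  shows "(\<integral>x. (f x)\<^sup>2 \<partial>M) \<le>
    (1 + e) * (\<integral>x. (g x)\<^sup>2 \<partial>M) + (1 + 1 / e) * (\<integral>x. (f x - g x)\<^sup>2 \<partial>M)"
proof -
  have *: "integrable M (\<lambda>x. (f x - g x)\<^sup>2)"
    "integrable M (\<lambda>x. (f x)\<^sup>2)" "integrable M (\<lambda>x. (g x)\<^sup>2)"
    using square_integrable_diff[OF assms(1,2)] assms by (auto simp: square_integrable_def)
  have "(\<integral>x. (f x)\<^sup>2 \<partial>M) \<le> (\<integral>x. (1 + e) * (g x)\<^sup>2 + (1 + 1 / e) * (f x - g x)\<^sup>2 \<partial>M)"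
    using * by (intro integral_mono) (auto intro: square_le_weighted[OF assms(3)])
  then show ?thesis using * by simp
qed

lemma integral_square_tendsto:
  assumes fn: "\<And>n. f n \<in> square_integrable M" and g: "g \<in> square_integrable M"
    and lim: "(\<lambda>n. \<integral>x. (f n x - g x)\<^sup>2 \<partial>M) \<longlonglongrightarrow> 0"
  shows "(\<lambda>n. \<integral>x. (f n x)\<^sup>2 \<partial>M) \<longlonglongrightarrow> (\<integral>x. (g x)\<^sup>2 \<partial>M)"
proof -
  define d where "d n = (\<integral>x. (f n x - g x)\<^sup>2 \<partial>M)" for n
  define p where "p n = (\<integral>x. (f n x)\<^sup>2 \<partial>M)" for n
  define a where "a = (\<integral>x. (g x)\<^sup>2 \<partial>M)"
  have d0: "d \<longlonglongrightarrow> 0" using lim by (simp add: d_def[abs_def])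
  have upper: "p n \<le> (1 + e) * a + (1 + 1 / e) * d n" if "e > 0" for e n
    using integral_square_le_weighted[OF fn g that] by (simp add: p_def a_def d_def)
  have lower: "a \<le> (1 + e) * p n + (1 + 1 / e) * d n" if "e > 0" for e n
    using integral_square_le_weighted[OF g fn that] by (simp add: p_def a_def d_def power2_commute)
  have a0: "a \<ge> 0" by (simp add: a_def)
  have "p \<longlonglongrightarrow> a"
  proof (rule tendstoI)
    fix e :: real assume e: "0 < e"
    \<comment> \<open>The weight \<open>c\<close> is small enough that both \<open>c * a\<close> and \<open>c * p n\<close>, where
      eventually \<open>p n \<le> 2 * a + 1\<close>, stay below \<open>e / 2\<close>.\<close>
    define c where "c = min 1 (e / (4 * (a + 1)))"
    have c: "0 < c" "c \<le> 1" using e a0 by (auto simp: c_def)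
    have "c * (a + 1) \<le> e / (4 * (a + 1)) * (a + 1)"
      using a0 by (intro mult_right_mono) (auto simp: c_def)
    also have "\<dots> = e / 4"
    proof -
      have "a + 1 \<noteq> 0" using a0 by linarith
      then show ?thesis by (simp add: divide_simps)
    qed
    finally have ca: "c * (a + 1) \<le> e / 4" .
    have "(\<lambda>n. (1 + 1 / c) * d n) \<longlonglongrightarrow> (1 + 1 / c) * 0" by (intro tendsto_intros d0)
    then have "\<forall>\<^sub>F n in sequentially. (1 + 1 / c) * d n < min (e / 4) 1"
      using e by (intro order_tendstoD(2)) auto
    then show "\<forall>\<^sub>F n in sequentially. dist (p n) a < e"
    proof eventually_elim
      case (elim n)
      have u: "p n \<le> a + c * a + (1 + 1 / c) * d n" and l: "a \<le> p n + c * p n + (1 + 1 / c) * d n"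
        using upper[OF c(1), of n] lower[OF c(1), of n] by (simp_all add: algebra_simps)
      have "c * a \<le> 1 * a" using c a0 by (intro mult_right_mono) auto
      then have "p n \<le> 2 * (a + 1)" using u elim a0 by auto
      then have "c * p n \<le> c * (2 * (a + 1))" using c by (intro mult_left_mono) auto
      then have "c * p n \<le> e / 2" using ca by (simp add: algebra_simps)
      moreover have "c * a \<le> e / 4" using ca c by (simp add: algebra_simps)
      ultimately show ?case using u l elim e by (auto simp: dist_real_def abs_less_iff)
    qed
  qed
  then show ?thesis by (simp add: p_def[abs_def] a_def)
qed

lemma nn_integral_square_fatou:
  assumes fn: "\<And>k. f k \<in> borel_measurable M"
    and lim: "AE x in M. (\<lambda>k. f k x) \<longlonglongrightarrow> g x"
    and bound: "\<forall>\<^sub>F k in sequentially. (\<integral>\<^sup>+ x. ennreal ((f k x)\<^sup>2) \<partial>M) \<le> c"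
  shows "(\<integral>\<^sup>+ x. ennreal ((g x)\<^sup>2) \<partial>M) \<le> c"
proof -
  note [measurable] = fn
  have "(\<integral>\<^sup>+ x. ennreal ((g x)\<^sup>2) \<partial>M) = (\<integral>\<^sup>+ x. liminf (\<lambda>k. ennreal ((f k x)\<^sup>2)) \<partial>M)"
  proof (rule nn_integral_cong_AE)
    show "AE x in M. ennreal ((g x)\<^sup>2) = liminf (\<lambda>k. ennreal ((f k x)\<^sup>2))"
      using lim
    proof eventually_elim
      case (elim x)
      then have "(\<lambda>k. ennreal ((f k x)\<^sup>2)) \<longlonglongrightarrow> ennreal ((g x)\<^sup>2)"
        by (intro tendsto_ennrealI tendsto_power)
      then show ?case by (rule lim_imp_Liminf[symmetric, OF trivial_limit_sequentially])
    qed
  qed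
  also have "\<dots> \<le> liminf (\<lambda>k. \<integral>\<^sup>+ x. ennreal ((f k x)\<^sup>2) \<partial>M)"
    by (rule nn_integral_liminf) measurable
  also have "\<dots> \<le> limsup (\<lambda>k. \<integral>\<^sup>+ x. ennreal ((f k x)\<^sup>2) \<partial>M)"
    by (rule Liminf_le_Limsup) simp
  also have "\<dots> \<le> c" using bound by (rule Limsup_bounded)
  finally show ?thesis .
qed

lemma tendsto_square_integral_AE_subseq:
  assumes "\<And>n. f n \<in> square_integrable M" and "g \<in> square_integrable M"
    and "(\<lambda>n. \<integral>x. (f n x - g x)\<^sup>2 \<partial>M) \<longlonglongrightarrow> 0"
  obtains r :: "nat \<Rightarrow> nat" where "strict_mono r" "AE x in M. (\<lambda>k. f (r k) x) \<longlonglongrightarrow> g x"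
proof -
  have "integrable M (\<lambda>x. (f n x - g x)\<^sup>2)" for n
    using square_integrable_diff[OF assms(1,2)] by (auto simp: square_integrable_def)
  then obtain r :: "nat \<Rightarrow> nat"
    where r: "strict_mono r" "AE x in M. (\<lambda>k. (f (r k) x - g x)\<^sup>2) \<longlonglongrightarrow> 0"
    using tendsto_L1_AE_subseq[of M "\<lambda>n x. (f n x - g x)\<^sup>2"] assms(3) by auto
  have "AE x in M. (\<lambda>k. f (r k) x) \<longlonglongrightarrow> g x"
    using r(2)
  proof eventually_elim
    case (elim x)
    then have "(\<lambda>k. sqrt ((f (r k) x - g x)\<^sup>2)) \<longlonglongrightarrow> sqrt 0" by (intro tendsto_real_sqrt)
    then have "(\<lambda>k. f (r k) x - g x) \<longlonglongrightarrow> 0" by (simp add: tendsto_rabs_zero_iff)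
    then show ?case by (rule LIM_zero_cancel)
  qed
  with r(1) show thesis by (rule that)
qed

text \<open>Riesz-Fischer. Along a subsequence with squared increments of integral at most \<open>4\<^sup>-\<^sup>k\<close>,
  the increments \<open>\<Delta>\<^sub>k\<close> satisfy \<open>\<bar>\<Delta>\<^sub>k\<bar> \<le> 2\<^sup>-\<^sup>k + 2\<^sup>k \<Delta>\<^sub>k\<^sup>2\<close>, and both terms are summable almost
  everywhere, the second because its sum has a finite integral. This replaces the usual argument
  by Minkowski's inequality and works on spaces of infinite measure.\<close>

lemma square_integrable_complete:
  assumes wn: "\<And>n. w n \<in> square_integrable M"
    and cauchy: "\<And>e. 0 < e \<Longrightarrow> \<exists>N. \<forall>m\<ge>N. \<forall>n\<ge>N. (\<integral>x. (w m x - w n x)\<^sup>2 \<partial>M) < e"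
  obtains p where "p \<in> square_integrable M" "(\<lambda>n. \<integral>x. (w n x - p x)\<^sup>2 \<partial>M) \<longlonglongrightarrow> 0"
proof -
  note [measurable] = square_integrableD(1)[OF wn]
  have "\<forall>k. \<exists>N. \<forall>m\<ge>N. \<forall>n\<ge>N. (\<integral>x. (w m x - w n x)\<^sup>2 \<partial>M) < (1/4)^k"
    using cauchy by simp
  then obtain N where N: "\<And>k m n. N k \<le> m \<Longrightarrow> N k \<le> n \<Longrightarrow> (\<integral>x. (w m x - w n x)\<^sup>2 \<partial>M) < (1/4)^k"
    by metis
  define s where "s k = (\<Sum>i\<le>k. N i) + k" for k
  have sN: "N k \<le> s k" for k
    unfolding s_def by (meson atMost_iff finite_atMost member_le_sum order_refl trans_le_add1 zero_le)
  have smono: "s k \<le> s (Suc k)" for k unfolding s_def by simp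
  have s_ge: "k \<le> s k" for k unfolding s_def by simp
  define \<Delta> where "\<Delta> k x = w (s (Suc k)) x - w (s k) x" for k x
  have [measurable]: "\<Delta> k \<in> borel_measurable M" for k unfolding \<Delta>_def by measurable
  have \<Delta>_int: "(\<integral>\<^sup>+ x. ennreal ((\<Delta> k x)\<^sup>2) \<partial>M) \<le> ennreal ((1/4)^k)" for k
  proof -
    have "(\<integral>\<^sup>+ x. ennreal ((\<Delta> k x)\<^sup>2) \<partial>M) = ennreal (\<integral>x. (\<Delta> k x)\<^sup>2 \<partial>M)"
      unfolding \<Delta>_def by (intro nn_integral_square_eq square_integrable_diff wn)
    also have "\<dots> \<le> ennreal ((1/4)^k)"
      unfolding \<Delta>_def using N[of k "s (Suc k)" "s k"] sN[of k] smono[of k]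
      by (intro ennreal_leI) auto
    finally show ?thesis .
  qed
  have "(\<integral>\<^sup>+ x. (\<Sum>k. ennreal (2^k * (\<Delta> k x)\<^sup>2)) \<partial>M) = (\<Sum>k. \<integral>\<^sup>+ x. ennreal (2^k * (\<Delta> k x)\<^sup>2) \<partial>M)"
    by (rule nn_integral_suminf) measurable
  also have "\<dots> \<le> (\<Sum>k. ennreal ((1/2)^k))"
  proof (rule suminf_le)
    fix k
    have "(\<integral>\<^sup>+ x. ennreal (2^k * (\<Delta> k x)\<^sup>2) \<partial>M) = ennreal (2^k) * (\<integral>\<^sup>+ x. ennreal ((\<Delta> k x)\<^sup>2) \<partial>M)"
      by (subst nn_integral_cmult[symmetric]) (auto simp: ennreal_mult)
    also have "\<dots> \<le> ennreal (2^k) * ennreal ((1/4)^k)" by (intro mult_left_mono \<Delta>_int) auto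
    also have "\<dots> = ennreal ((1/2)^k)"
      by (simp add: ennreal_mult[symmetric] power_mult_distrib[symmetric])
    finally show "(\<integral>\<^sup>+ x. ennreal (2^k * (\<Delta> k x)\<^sup>2) \<partial>M) \<le> ennreal ((1/2)^k)" .
  qed auto
  also have "\<dots> = ennreal (\<Sum>k. (1/2)^k)" by (intro suminf_ennreal2) (auto intro: summable_geometric)
  also have "\<dots> < \<infinity>" by simp
  finally have "AE x in M. (\<Sum>k. ennreal (2^k * (\<Delta> k x)\<^sup>2)) \<noteq> \<infinity>"
    by (intro nn_integral_noteq_infinite) (auto simp: top_unique)
  then have conv: "AE x in M. convergent (\<lambda>k. w (s k) x)"
  proof eventually_elim
    case (elim x)
    then have "summable (\<lambda>k. 2^k * (\<Delta> k x)\<^sup>2)" by (intro summable_suminf_not_top) auto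
    moreover have "summable (\<lambda>k. (1/2::real)^k)" by (intro summable_geometric) auto
    ultimately have "summable (\<lambda>k. (1/2)^k + 2^k * (\<Delta> k x)\<^sup>2)" by (intro summable_add)
    then have "summable (\<lambda>k. \<Delta> k x)"
    proof (rule summable_comparison_test'[where N = 0])
      fix k
      have half: "(2::real)^k * (1/2)^k = 1" by (simp add: power_mult_distrib[symmetric])
      have "\<bar>\<Delta> k x\<bar> \<le> (1/2)^k + 2^k * (\<Delta> k x)\<^sup>2"
      proof (cases "2^k * \<bar>\<Delta> k x\<bar> \<le> 1")
        case True
        then have "(1/2)^k * (2^k * \<bar>\<Delta> k x\<bar>) \<le> (1/2)^k * 1" by (intro mult_left_mono) auto
        moreover have "(1/2)^k * (2^k * \<bar>\<Delta> k x\<bar>) = (2^k * (1/2)^k) * \<bar>\<Delta> k x\<bar>" by (simp only: mult_ac)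
        ultimately have "\<bar>\<Delta> k x\<bar> \<le> (1/2)^k" using half by simp
        then show ?thesis by (simp add: add_increasing2)
      next
        case False
        then have "1 * \<bar>\<Delta> k x\<bar> \<le> (2^k * \<bar>\<Delta> k x\<bar>) * \<bar>\<Delta> k x\<bar>" by (intro mult_right_mono) auto
        also have "\<dots> = 2^k * (\<Delta> k x)\<^sup>2" by (simp add: power2_eq_square mult.assoc abs_mult_self_eq)
        finally show ?thesis by (simp add: add_increasing)
      qed
      then show "norm (\<Delta> k x) \<le> (1/2)^k + 2^k * (\<Delta> k x)\<^sup>2" by simp
    qed
    then have "(\<lambda>n. w (s 0) x + (\<Sum>k<n. \<Delta> k x)) \<longlonglongrightarrow> w (s 0) x + (\<Sum>k. \<Delta> k x)"
      by (intro tendsto_intros summable_LIMSEQ)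
    moreover have "w (s 0) x + (\<Sum>k<n. \<Delta> k x) = w (s n) x" for n
      by (induction n) (auto simp: \<Delta>_def)
    ultimately show ?case by (auto simp: convergent_def)
  qed
  define p where "p x = lim (\<lambda>k. w (s k) x)" for x
  have [measurable]: "p \<in> borel_measurable M" unfolding p_def by measurable
  have lim: "AE x in M. (\<lambda>k. w (s k) x) \<longlonglongrightarrow> p x"
    using conv by eventually_elim (simp add: p_def convergent_LIMSEQ_iff)
  have small: "\<exists>K. \<forall>n\<ge>K. (\<integral>\<^sup>+ x. ennreal ((w n x - p x)\<^sup>2) \<partial>M) \<le> ennreal e" if e: "0 < e" for e
  proof -
    obtain K where K: "\<And>m n. K \<le> m \<Longrightarrow> K \<le> n \<Longrightarrow> (\<integral>x. (w m x - w n x)\<^sup>2 \<partial>M) < e"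
      using cauchy[OF e] by blast
    have "(\<integral>\<^sup>+ x. ennreal ((w n x - p x)\<^sup>2) \<partial>M) \<le> ennreal e" if n: "K \<le> n" for n
    proof (rule nn_integral_square_fatou[where f = "\<lambda>k x. w n x - w (s k) x"])
      show "AE x in M. (\<lambda>k. w n x - w (s k) x) \<longlonglongrightarrow> w n x - p x"
        using lim by eventually_elim (intro tendsto_intros)
      show "\<forall>\<^sub>F k in sequentially. (\<integral>\<^sup>+ x. ennreal ((w n x - w (s k) x)\<^sup>2) \<partial>M) \<le> ennreal e"
        using eventually_ge_at_top[of K]
      proof eventually_elim
        case (elim k)
        then have "K \<le> s k" using s_ge[of k] by linarith
        then show ?case
          using K[OF n] by (simp add: nn_integral_square_eq square_integrable_diff wn
              ennreal_leI less_imp_le)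
      qed
    qed measurable
    then show ?thesis by blast
  qed
  obtain K where "(\<integral>\<^sup>+ x. ennreal ((w K x - p x)\<^sup>2) \<partial>M) \<le> ennreal 1"
    using small[of 1] by auto
  then have "(\<lambda>x. w K x - p x) \<in> square_integrable M"
    by (subst square_integrable_iff_finite) (auto intro: le_less_trans)
  from square_integrable_diff[OF wn[of K] this] have p: "p \<in> square_integrable M" by simp
  have "(\<lambda>n. \<integral>x. (w n x - p x)\<^sup>2 \<partial>M) \<longlonglongrightarrow> 0"
  proof (rule LIMSEQ_I)
    fix e :: real assume e: "0 < e"
    then obtain K where K: "\<forall>n\<ge>K. (\<integral>\<^sup>+ x. ennreal ((w n x - p x)\<^sup>2) \<partial>M) \<le> ennreal (e / 2)"
      using small[of "e / 2"] by auto
    have "norm ((\<integral>x. (w n x - p x)\<^sup>2 \<partial>M) - 0) < e" if "n \<ge> K" for n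
    proof -
      have "ennreal (\<integral>x. (w n x - p x)\<^sup>2 \<partial>M) \<le> ennreal (e / 2)"
        using K that by (simp add: nn_integral_square_eq[symmetric] square_integrable_diff wn p)
      then have "(\<integral>x. (w n x - p x)\<^sup>2 \<partial>M) \<le> e / 2" using e by (simp add: ennreal_le_iff)
      then show ?thesis using e by simp
    qed
    then show "\<exists>K. \<forall>n\<ge>K. norm ((\<integral>x. (w n x - p x)\<^sup>2 \<partial>M) - 0) < e" by blast
  qed
  with p show thesis by (rule that)
qed

section \<open>Minimizing sequences in convex sets\<close>

text \<open>The geometry behind both the projection theorem and the Banach-Saks property of Hilbert
  spaces. Midpoints of near-minimizers cannot have a much smaller value of \<open>q\<close>, so the
  parallelogram law forces the squared distance \<open>d\<close> between near-minimizers to be small. The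
  sets may shrink: their infima increase to a finite limit, and this is all that is needed.\<close>

lemma minimizing_sequence_Cauchy:
  fixes q :: "'b \<Rightarrow> real" and K :: "nat \<Rightarrow> 'b set"
  assumes decseq: "decseq K"
    and bounded: "\<And>n. \<exists>f\<in>K n. q f \<le> L"
    and nonneg: "\<And>f. 0 \<le> q f"
    and mid: "\<And>n f g. f \<in> K n \<Longrightarrow> g \<in> K n \<Longrightarrow> mid f g \<in> K n"
    and parallelogram:
      "\<And>f g. f \<in> K 0 \<Longrightarrow> g \<in> K 0 \<Longrightarrow> d f g + 4 * q (mid f g) = 2 * q f + 2 * q g"
  obtains w where "\<And>n. w n \<in> K n" "\<And>n v. v \<in> K n \<Longrightarrow> q (w n) \<le> q v + 1 / real (Suc n)"
    "\<And>e. 0 < e \<Longrightarrow> \<exists>N. \<forall>m\<ge>N. \<forall>n\<ge>N. d (w m) (w n) < e"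
proof -
  define a where "a n = Inf (q ` K n)" for n
  have bdd: "bdd_below (q ` K n)" for n using nonneg by (intro bdd_belowI[of _ 0]) auto
  have a_le: "a n \<le> q v" if "v \<in> K n" for n v
    unfolding a_def using bdd that by (intro cInf_lower) auto
  have sub: "K n \<subseteq> K m" if "m \<le> n" for m n using decseq that by (rule decseqD)
  have "\<exists>f. f \<in> K n \<and> q f < a n + 1 / real (Suc n)" for n
  proof -
    have "q ` K n \<noteq> {}" using bounded[of n] by blast
    moreover have "Inf (q ` K n) < a n + 1 / real (Suc n)" by (simp add: a_def)
    ultimately have "\<exists>z\<in>q ` K n. z < a n + 1 / real (Suc n)" by (rule cInf_lessD)
    then show ?thesis by auto
  qed
  then obtain w where w: "\<And>n. w n \<in> K n" "\<And>n. q (w n) < a n + 1 / real (Suc n)" by metis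
  have "incseq a"
  proof (rule monoI)
    fix m n :: nat assume "m \<le> n"
    then have "q ` K n \<subseteq> q ` K m" by (intro image_mono sub)
    moreover have "q ` K n \<noteq> {}" using bounded[of n] by blast
    ultimately show "a m \<le> a n" unfolding a_def by (intro cInf_superset_mono bdd)
  qed
  moreover have "a n \<le> L" for n
  proof -
    obtain f where "f \<in> K n" "q f \<le> L" using bounded by blast
    then show ?thesis using a_le[of f n] by linarith
  qed
  ultimately obtain a' where a': "a \<longlonglongrightarrow> a'" "\<And>n. a n \<le> a'"
    using incseq_convergent by metis
  have cauchy: "\<exists>N. \<forall>m\<ge>N. \<forall>n\<ge>N. d (w m) (w n) < e" if e: "0 < e" for e
  proof -
    have "(\<lambda>n. 4 * (a' - a n) + 4 * (1 / real (Suc n))) \<longlonglongrightarrow> 4 * (a' - a') + 4 * 0"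
      by (intro tendsto_intros a' LIMSEQ_Suc[OF lim_1_over_n])
    then have "\<forall>\<^sub>F n in sequentially. 4 * (a' - a n) + 4 * (1 / real (Suc n)) < e"
      using e by (intro order_tendstoD(2)) auto
    then obtain N where N: "4 * (a' - a N) + 4 * (1 / real (Suc N)) < e"
      using eventually_happens'[OF sequentially_bot] by blast
    have "d (w m) (w n) < e" if mn: "N \<le> m" "N \<le> n" for m n
    proof -
      have "w m \<in> K N" "w n \<in> K N" using w(1) sub mn by blast+
      then have "a N \<le> q (mid (w m) (w n))" by (intro a_le mid)
      moreover have "d (w m) (w n) + 4 * q (mid (w m) (w n)) = 2 * q (w m) + 2 * q (w n)"
        using w(1) sub by (intro parallelogram) blast+
      moreover have "q (w m) < a' + 1 / real (Suc N)" "q (w n) < a' + 1 / real (Suc N)"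
      proof -
        have "1 / real (Suc m) \<le> 1 / real (Suc N)" "1 / real (Suc n) \<le> 1 / real (Suc N)"
          using mn by (auto intro!: divide_left_mono)
        then show "q (w m) < a' + 1 / real (Suc N)" "q (w n) < a' + 1 / real (Suc N)"
          using w(2)[of m] w(2)[of n] a'(2)[of m] a'(2)[of n] by linarith+
      qed
      ultimately show ?thesis using N by argo
    qed
    then show ?thesis by blast
  qed
  show thesis
  proof (rule that[of w])
    show "q (w n) \<le> q v + 1 / real (Suc n)" if "v \<in> K n" for n v
      using w(2)[of n] a_le[OF that] by linarith
  qed (use w(1) cauchy in blast)+
qed

text \<open>Mazur's theorem, in the form that the weak limit \<open>u\<close> of a sequence that is infinitely often in
  a convex set \<open>K\<close> belongs to the strong closure of \<open>K\<close>. The nearest point \<open>p\<close> to \<open>u\<close> in the closure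
  of \<open>K\<close> satisfies the variational inequality \<open>\<integral>(p - u)(v - p) \<ge> 0\<close> for all \<open>v \<in> K\<close>. Taking
  \<open>v = us m\<close> and letting \<open>m\<close> tend to infinity turns it into \<open>- \<integral>(p - u)\<^sup>2 \<ge> 0\<close>.\<close>

lemma mazur_square_integrable:
  assumes K: "K \<subseteq> square_integrable M"
    and conv: "\<And>f g t. f \<in> K \<Longrightarrow> g \<in> K \<Longrightarrow> 0 \<le> t \<Longrightarrow> t \<le> 1 \<Longrightarrow>
      (\<lambda>x. (1 - t) * f x + t * g x) \<in> K"
    and u: "u \<in> square_integrable M"
    and freq: "\<exists>\<^sub>F n in sequentially. us n \<in> K"
    and weak: "\<And>v. v \<in> square_integrable M \<Longrightarrow>
      (\<lambda>n. \<integral>x. us n x * v x \<partial>M) \<longlonglongrightarrow> (\<integral>x. u x * v x \<partial>M)"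
  obtains w where "\<And>n. w n \<in> K" "(\<lambda>n. \<integral>x. (w n x - u x)\<^sup>2 \<partial>M) \<longlonglongrightarrow> 0"
proof -
  let ?q = "\<lambda>f. \<integral>x. (f x - u x)\<^sup>2 \<partial>M"
  obtain f0 where f0: "f0 \<in> K" using freq frequently_ex by blast
  have mid: "(\<lambda>x. (f x + g x) / 2) \<in> K" if "f \<in> K" "g \<in> K" for f g
    using conv[OF that, of "1/2"] by (simp add: add_divide_distrib)
  have par: "(\<integral>x. (f x - g x)\<^sup>2 \<partial>M) + 4 * ?q (\<lambda>x. (f x + g x) / 2) = 2 * ?q f + 2 * ?q g"
    if "f \<in> K" "g \<in> K" for f g
    using integral_parallelogram_midpoint[of "\<lambda>x. f x - u x" M "\<lambda>x. g x - u x"] that K u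
    by (simp add: square_integrable_diff subset_iff field_simps)
  obtain w where wK: "\<And>n. w n \<in> K"
    and wmin: "\<And>n v. v \<in> K \<Longrightarrow> ?q (w n) \<le> ?q v + 1 / real (Suc n)"
    and wcau: "\<And>e. 0 < e \<Longrightarrow> \<exists>N. \<forall>m\<ge>N. \<forall>n\<ge>N. (\<integral>x. (w m x - w n x)\<^sup>2 \<partial>M) < e"
  proof (rule minimizing_sequence_Cauchy[where K = "\<lambda>n. K" and q = ?q and L = "?q f0"
        and mid = "\<lambda>f g x. (f x + g x) / 2" and d = "\<lambda>f g. \<integral>x. (f x - g x)\<^sup>2 \<partial>M"])
    show "\<exists>f\<in>K. ?q f \<le> ?q f0" using f0 by blast
  qed (use mid par in \<open>auto simp: decseq_def\<close>)
  have w2: "w n \<in> square_integrable M" for n using wK K by blast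
  obtain p where p: "p \<in> square_integrable M" and wp: "(\<lambda>n. \<integral>x. (w n x - p x)\<^sup>2 \<partial>M) \<longlonglongrightarrow> 0"
    using square_integrable_complete[of w M] w2 wcau by blast
  have qlim: "(\<lambda>n. ?q (\<lambda>x. (1 - t) * w n x + t * v x)) \<longlonglongrightarrow> ?q (\<lambda>x. (1 - t) * p x + t * v x)"
    if v: "v \<in> square_integrable M" for v t
  proof (rule integral_square_tendsto)
    show "(\<lambda>x. (1 - t) * w n x + t * v x - u x) \<in> square_integrable M" for n
      by (intro square_integrable_diff square_integrable_add square_integrable_scale w2 v u)
    show "(\<lambda>x. (1 - t) * p x + t * v x - u x) \<in> square_integrable M"
      by (intro square_integrable_diff square_integrable_add square_integrable_scale p v u)
    have "((1 - t) * w n x + t * v x - u x - ((1 - t) * p x + t * v x - u x))\<^sup>2 =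
        (1 - t)\<^sup>2 * (w n x - p x)\<^sup>2" for n x
      by (simp add: power_mult_distrib[symmetric] algebra_simps)
    then show "(\<lambda>n. \<integral>x. ((1 - t) * w n x + t * v x - u x - ((1 - t) * p x + t * v x - u x))\<^sup>2 \<partial>M)
        \<longlonglongrightarrow> 0"
      using tendsto_mult_right_zero[OF wp, of "(1 - t)\<^sup>2"] by simp
  qed
  have pmin: "?q p \<le> ?q (\<lambda>x. (1 - t) * p x + t * v x)" if v: "v \<in> K" and t: "0 \<le> t" "t \<le> 1" for v t
  proof (rule LIMSEQ_le)
    have v2: "v \<in> square_integrable M" using v K by blast
    show "(\<lambda>n. ?q (w n)) \<longlonglongrightarrow> ?q p" using qlim[OF v2, of 0] by simp
    show "(\<lambda>n. ?q (\<lambda>x. (1 - t) * w n x + t * v x) + 1 / real (Suc n)) \<longlonglongrightarrow>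
        ?q (\<lambda>x. (1 - t) * p x + t * v x)"
      using tendsto_add[OF qlim[OF v2, of t] LIMSEQ_Suc[OF lim_1_over_n]] by simp
    show "\<exists>N. \<forall>n\<ge>N. ?q (w n) \<le> ?q (\<lambda>x. (1 - t) * w n x + t * v x) + 1 / real (Suc n)"
      using wmin[OF conv[OF wK v t]] by blast
  qed
  have var: "0 \<le> (\<integral>x. (p x - u x) * (v x - p x) \<partial>M)" if v: "v \<in> K" for v
  proof -
    let ?I = "\<integral>x. (p x - u x) * (v x - p x) \<partial>M" and ?D = "\<integral>x. (v x - p x)\<^sup>2 \<partial>M"
    have v2: "v \<in> square_integrable M" using v K by blast
    note diffs = square_integrable_diff[OF p u] square_integrable_diff[OF v2 p]
    have expand: "?q (\<lambda>x. (1 - t) * p x + t * v x) = ?q p + 2 * t * ?I + t\<^sup>2 * ?D" for t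
    proof -
      have "?q (\<lambda>x. (1 - t) * p x + t * v x) =
          (\<integral>x. (p x - u x)\<^sup>2 + 2 * t * ((p x - u x) * (v x - p x)) + t\<^sup>2 * (v x - p x)\<^sup>2 \<partial>M)"
        by (intro Bochner_Integration.integral_cong) (auto simp: power2_eq_square algebra_simps)
      then show ?thesis
        using square_integrable_mult[OF diffs] square_integrableD(2)[OF diffs(1)]
          square_integrableD(2)[OF diffs(2)] by simp
    qed
    have ineq: "0 \<le> 2 * ?I + t * ?D" if t: "0 < t" "t \<le> 1" for t
    proof -
      have "0 \<le> t * (2 * ?I + t * ?D)"
        using pmin[OF v, of t] t expand[of t] by (simp add: power2_eq_square algebra_simps)
      then show ?thesis using t by (simp add: zero_le_mult_iff)
    qed
    have "((\<lambda>t. 2 * ?I + t * ?D) \<longlongrightarrow> 2 * ?I + 0 * ?D) (at_right 0)" by (intro tendsto_intros)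
    moreover have "\<forall>\<^sub>F t in at_right (0::real). 0 \<le> 2 * ?I + t * ?D"
      using eventually_at_right_less[of 0] eventually_at_right_real[OF zero_less_one]
      by eventually_elim (use ineq in auto)
    ultimately have "0 \<le> 2 * ?I + 0 * ?D"
      by (intro tendsto_lowerbound) (auto simp: trivial_limit_at_right_real)
    then show ?thesis by simp
  qed
  have pu: "(\<lambda>x. p x - u x) \<in> square_integrable M" using p u by (rule square_integrable_diff)
  have split: "(\<integral>x. (p x - u x) * (v x - p x) \<partial>M) =
      (\<integral>x. v x * (p x - u x) \<partial>M) - (\<integral>x. p x * (p x - u x) \<partial>M)"
    if "v \<in> square_integrable M" for v
    using square_integrable_mult[OF that pu] square_integrable_mult[OF p pu]
    by (simp add: algebra_simps flip: Bochner_Integration.integral_diff)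
  have "(\<lambda>n. (\<integral>x. us n x * (p x - u x) \<partial>M) - (\<integral>x. p x * (p x - u x) \<partial>M)) \<longlonglongrightarrow>
      (\<integral>x. u x * (p x - u x) \<partial>M) - (\<integral>x. p x * (p x - u x) \<partial>M)"
    by (intro tendsto_intros weak pu)
  moreover have "(\<integral>x. u x * (p x - u x) \<partial>M) - (\<integral>x. p x * (p x - u x) \<partial>M) = - ?q p"
    using split[OF u] by (simp add: power2_eq_square algebra_simps flip: integral_minus)
  ultimately have lim: "(\<lambda>n. (\<integral>x. us n x * (p x - u x) \<partial>M) - (\<integral>x. p x * (p x - u x) \<partial>M)) \<longlonglongrightarrow> - ?q p"
    by simp
  have "\<not> - ?q p < 0"
  proof
    assume "- ?q p < 0"
    with lim have "\<forall>\<^sub>F n in sequentially.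
        (\<integral>x. us n x * (p x - u x) \<partial>M) - (\<integral>x. p x * (p x - u x) \<partial>M) < 0"
      by (rule order_tendstoD(2))
    with freq have "\<exists>\<^sub>F n in sequentially.
        (\<integral>x. us n x * (p x - u x) \<partial>M) - (\<integral>x. p x * (p x - u x) \<partial>M) < 0 \<and> us n \<in> K"
      by (simp add: frequently_eventually_conj)
    then obtain n where "us n \<in> K"
      "(\<integral>x. us n x * (p x - u x) \<partial>M) - (\<integral>x. p x * (p x - u x) \<partial>M) < 0"
      using frequently_ex by blast
    then show False using var[of "us n"] split[of "us n"] K by auto
  qed
  moreover have "0 \<le> ?q p" by simp
  ultimately have "?q p = 0" by linarith
  moreover have "(\<lambda>n. ?q (w n)) \<longlonglongrightarrow> ?q p" using qlim[OF p, of 0] by simp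
  ultimately show thesis using wK by (intro that[of w]) auto
qed

section \<open>Lebesgue measure on the product space\<close>

text \<open>Functions on the product are measurable with respect to the completed product measure, which
  is strictly larger than the product of the completed measures. The projections therefore have
  to be treated as maps that pull null sets back to null sets.\<close>

lemma lebesgue_null_preimage:
  fixes f :: "'a::euclidean_space \<Rightarrow> 'b::euclidean_space"
  assumes f: "f \<in> borel_measurable borel"
    and null: "\<And>N. N \<in> null_sets lborel \<Longrightarrow> f -` N \<in> null_sets lborel"
  shows "f \<in> lebesgue \<rightarrow>\<^sub>M lebesgue"
    and "AE y in lebesgue. P y \<Longrightarrow> AE x in lebesgue. P (f x)"
proof -
  show "f \<in> lebesgue \<rightarrow>\<^sub>M lebesgue"
  proof (rule completion.measurable_completion2)
    show m: "f \<in> lebesgue \<rightarrow>\<^sub>M lborel" using f by (intro measurable_completion) simp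
    show "null_sets lborel \<subseteq> null_sets (distr lebesgue lborel f)"
    proof
      fix N :: "'b set" assume N: "N \<in> null_sets lborel"
      have "f -` N \<in> null_sets lebesgue" using null[OF N] by (rule null_sets_completionI)
      then show "N \<in> null_sets (distr lebesgue lborel f)"
        using N m by (auto simp: null_sets_def emeasure_distr)
    qed
  qed
  assume "AE y in lebesgue. P y"
  then have "AE y in lborel. P y" by (simp add: AE_completion_iff)
  then obtain N where N: "N \<in> null_sets lborel" "{y. \<not> P y} \<subseteq> N"
    by (auto simp: eventually_ae_filter)
  have "AE x in lborel. P (f x)" by (rule AE_I'[OF null[OF N(1)]]) (use N(2) in auto)
  then show "AE x in lebesgue. P (f x)" by (rule AE_completion)
qed

lemma null_sets_lborel_fst:
  assumes "N \<in> null_sets (lborel :: 'a::euclidean_space measure)"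
  shows "fst -` N \<in> null_sets (lborel :: ('a \<times> 'b::euclidean_space) measure)"
proof -
  have "N \<times> UNIV \<in> null_sets (lborel \<Otimes>\<^sub>M (lborel :: 'b measure))"
    using assms by (intro lborel.times_in_null_sets1) auto
  moreover have "fst -` N = N \<times> (UNIV :: 'b set)" by auto
  ultimately show ?thesis by (simp add: lborel_prod)
qed

lemma null_sets_lborel_snd:
  assumes "N \<in> null_sets (lborel :: 'b::euclidean_space measure)"
  shows "snd -` N \<in> null_sets (lborel :: ('a::euclidean_space \<times> 'b) measure)"
proof -
  have "UNIV \<times> N \<in> null_sets ((lborel :: 'a measure) \<Otimes>\<^sub>M lborel)"
    using assms by (intro lborel.times_in_null_sets2) auto
  moreover have "snd -` N = (UNIV :: 'a set) \<times> N" by auto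
  ultimately show ?thesis by (simp add: lborel_prod)
qed

lemma borel_measurable_fst_snd:
  "(fst :: 'a::euclidean_space \<times> 'b::euclidean_space \<Rightarrow> 'a) \<in> borel_measurable borel"
  "(snd :: 'a::euclidean_space \<times> 'b::euclidean_space \<Rightarrow> 'b) \<in> borel_measurable borel"
  by (auto intro!: borel_measurable_continuous_onI continuous_intros)

lemma lebesgue_fst:
  fixes P :: "'a::euclidean_space \<Rightarrow> bool"
  shows measurable_lebesgue_fst: "(fst :: 'a \<times> 'b::euclidean_space \<Rightarrow> 'a) \<in> lebesgue \<rightarrow>\<^sub>M lebesgue"
    and AE_lebesgue_fst: "AE x in lebesgue. P x \<Longrightarrow> AE z in (lebesgue :: ('a \<times> 'b) measure). P (fst z)"
  by (rule lebesgue_null_preimage[OF borel_measurable_fst_snd(1)]; (rule null_sets_lborel_fst)?; assumption)+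

lemma lebesgue_snd:
  fixes P :: "'b::euclidean_space \<Rightarrow> bool"
  shows measurable_lebesgue_snd: "(snd :: 'a::euclidean_space \<times> 'b \<Rightarrow> 'b) \<in> lebesgue \<rightarrow>\<^sub>M lebesgue"
    and AE_lebesgue_snd: "AE x in lebesgue. P x \<Longrightarrow> AE z in (lebesgue :: ('a \<times> 'b) measure). P (snd z)"
  by (rule lebesgue_null_preimage[OF borel_measurable_fst_snd(2)]; (rule null_sets_lborel_snd)?; assumption)+

section \<open>The form of a jump kernel\<close>

definition increment :: "('a \<Rightarrow> real) \<Rightarrow> 'a \<times> 'a \<Rightarrow> real" where
  "increment f z = f (snd z) - f (fst z)"

text \<open>With respect to this measure the form is the squared \<open>L\<^sup>2\<close> norm of \<^const>\<open>increment\<close>, which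
  depends linearly on the function.\<close>

definition kernel_measure :: "('a::euclidean_space \<Rightarrow> 'a \<Rightarrow> real) \<Rightarrow> ('a \<times> 'a) measure" where
  "kernel_measure J = density lebesgue (\<lambda>z. ennreal (J (fst z) (snd z)))"

lemma increment_measurable:
  assumes "f \<in> borel_measurable lebesgue"
  shows "increment f \<in> borel_measurable lebesgue"
  unfolding increment_def[abs_def]
  by (intro borel_measurable_diff measurable_compose[OF measurable_lebesgue_snd assms]
      measurable_compose[OF measurable_lebesgue_fst assms])

text \<open>A single estimate for the convexity of the form, its subadditivity up to a factor, and the
  weighted triangle inequality: each is a pointwise inequality between quadratic expressions.\<close>

lemma nn_integral_square_linear_bound:
  assumes [measurable]: "f \<in> borel_measurable M" "g \<in> borel_measurable M"
    and "0 \<le> a" "0 \<le> b"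
    and bound: "\<And>p q. (c * p + d * q)\<^sup>2 \<le> a * p\<^sup>2 + b * q\<^sup>2"
  shows "(\<integral>\<^sup>+ x. ennreal ((c * f x + d * g x)\<^sup>2) \<partial>M) \<le>
    ennreal a * (\<integral>\<^sup>+ x. ennreal ((f x)\<^sup>2) \<partial>M) + ennreal b * (\<integral>\<^sup>+ x. ennreal ((g x)\<^sup>2) \<partial>M)"
proof -
  have "(\<integral>\<^sup>+ x. ennreal ((c * f x + d * g x)\<^sup>2) \<partial>M) \<le>
      (\<integral>\<^sup>+ x. ennreal a * ennreal ((f x)\<^sup>2) + ennreal b * ennreal ((g x)\<^sup>2) \<partial>M)"
  proof (rule nn_integral_mono)
    fix x
    show "ennreal ((c * f x + d * g x)\<^sup>2) \<le>
        ennreal a * ennreal ((f x)\<^sup>2) + ennreal b * ennreal ((g x)\<^sup>2)"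
      using bound[of "f x" "g x"] assms(3,4)
      by (simp add: ennreal_mult[symmetric] ennreal_plus[symmetric] ennreal_leI del: ennreal_plus)
  qed
  also have "\<dots> = ennreal a * (\<integral>\<^sup>+ x. ennreal ((f x)\<^sup>2) \<partial>M) + ennreal b * (\<integral>\<^sup>+ x. ennreal ((g x)\<^sup>2) \<partial>M)"
    by (simp add: nn_integral_add nn_integral_cmult)
  finally show ?thesis .
qed

lemma convex_combination_square_le:
  fixes p q t :: real
  assumes "0 \<le> t" "t \<le> 1"
  shows "((1 - t) * p + t * q)\<^sup>2 \<le> (1 - t) * p\<^sup>2 + t * q\<^sup>2"
proof -
  have "(1 - t) * p\<^sup>2 + t * q\<^sup>2 - ((1 - t) * p + t * q)\<^sup>2 = t * (1 - t) * (p - q)\<^sup>2"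
    by (simp add: power2_eq_square algebra_simps)
  moreover have "0 \<le> t * (1 - t) * (p - q)\<^sup>2" using assms by simp
  ultimately show ?thesis by linarith
qed

lemma square_add_le:
  fixes p q :: real
  shows "(1 * p + 1 * q)\<^sup>2 \<le> 2 * p\<^sup>2 + 2 * q\<^sup>2"
  using sum_squares_bound[of p q] by (simp add: power2_sum)

lemma L2_eq_square_integrable: "L2 = square_integrable lebesgue"
  by (auto simp: L2_def square_integrable_def)

lemma L2_measurable: "f \<in> L2 \<Longrightarrow> f \<in> borel_measurable lebesgue"
  by (simp add: L2_def)

lemma C1_compact_support_imp_L2:
  assumes "f \<in> C1_compact_support"
  shows "f \<in> L2"
proof -
  obtain f' where "\<And>x. (f has_derivative blinfun_apply (f' x)) (at x)"
    and S: "compact (closure {x. f x \<noteq> 0})" (is "compact ?S")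
    using assms by (auto simp: C1_compact_support_def)
  then have cont: "continuous_on UNIV f"
    by (auto intro!: continuous_at_imp_continuous_on has_derivative_continuous)
  then have [measurable]: "f \<in> borel_measurable borel" by (rule borel_measurable_continuous_onI)
  have "integrable lborel (\<lambda>x. indicator ?S x *\<^sub>R (f x)\<^sup>2)"
    by (intro borel_integrable_compact S continuous_intros continuous_on_subset[OF cont]) auto
  moreover have "indicator ?S x *\<^sub>R (f x)\<^sup>2 = (f x)\<^sup>2" for x
    using closure_subset[of "{x. f x \<noteq> 0}"] by (auto simp: indicator_def)
  ultimately have "integrable lborel (\<lambda>x. (f x)\<^sup>2)" by (simp only:)
  then show ?thesis by (auto simp: L2_def integrable_completion intro: measurable_completion)
qed

lemma C1_compact_support_linear:
  assumes f: "f \<in> C1_compact_support" and g: "g \<in> C1_compact_support"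
  shows "(\<lambda>x. c * f x + d * g x) \<in> C1_compact_support"
proof -
  obtain f' where f': "\<And>x. (f has_derivative blinfun_apply (f' x)) (at x)" "continuous_on UNIV f'"
    and cf: "compact (closure {x. f x \<noteq> 0})"
    using f by (auto simp: C1_compact_support_def)
  obtain g' where g': "\<And>x. (g has_derivative blinfun_apply (g' x)) (at x)" "continuous_on UNIV g'"
    and cg: "compact (closure {x. g x \<noteq> 0})"
    using g by (auto simp: C1_compact_support_def)
  have deriv: "((\<lambda>x. c * f x + d * g x) has_derivative blinfun_apply (c *\<^sub>R f' x + d *\<^sub>R g' x)) (at x)" for x
    by (auto intro!: derivative_eq_intros f' g' simp: blinfun.add_left blinfun.scaleR_left)
  have cont: "continuous_on UNIV (\<lambda>x. c *\<^sub>R f' x + d *\<^sub>R g' x)"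
    by (intro continuous_intros f' g')
  have supp: "compact (closure {x. c * f x + d * g x \<noteq> 0})"
  proof -
    have "closure {x. c * f x + d * g x \<noteq> 0} \<subseteq> closure ({x. f x \<noteq> 0} \<union> {x. g x \<noteq> 0})"
      by (intro closure_mono) auto
    then have eq: "closure {x. c * f x + d * g x \<noteq> 0} =
        (closure {x. f x \<noteq> 0} \<union> closure {x. g x \<noteq> 0}) \<inter> closure {x. c * f x + d * g x \<noteq> 0}"
      by (auto simp: closure_Un)
    show ?thesis
      by (subst eq) (intro compact_Int_closed compact_Un cf cg closed_closure)
  qed
  show ?thesis
    unfolding C1_compact_support_def
    by (intro CollectI conjI exI[of _ "\<lambda>x. c *\<^sub>R f' x + d *\<^sub>R g' x"] allI deriv cont supp)
qed

text \<open>Enlarging the kernel strengthens the norm, so closures of the same core shrink. Kernels need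
  to be compared only off the diagonal because the increment vanishes on it.\<close>

lemma form_mono:
  assumes "\<And>x y. x \<noteq> y \<Longrightarrow> J x y \<le> J' x y"
  shows "form J f \<le> form J' f"
  unfolding form_def
proof (intro nn_integral_mono ennreal_leI)
  fix z
  show "(f (snd z) - f (fst z))\<^sup>2 * J (fst z) (snd z) \<le> (f (snd z) - f (fst z))\<^sup>2 * J' (fst z) (snd z)"
    using assms by (cases "fst z = snd z") (auto intro: mult_left_mono)
qed

lemma form_domainI:
  assumes "f \<in> L2" "\<And>n. g n \<in> C1_compact_support"
    "(\<lambda>n. form1 J (\<lambda>x. f x - g n x)) \<longlonglongrightarrow> 0"
  shows "f \<in> form_domain J"
  using assms unfolding form_domain_def by blast

lemma form_domainE:
  assumes "f \<in> form_domain J"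
  obtains g where "f \<in> L2" "\<And>n. g n \<in> C1_compact_support"
    "(\<lambda>n. form1 J (\<lambda>x. f x - g n x)) \<longlonglongrightarrow> 0"
  using assms unfolding form_domain_def by blast

lemma form_domain_antimono:
  assumes "\<And>x y. x \<noteq> y \<Longrightarrow> J x y \<le> J' x y"
  shows "form_domain J' \<subseteq> form_domain J"
proof
  fix f assume "f \<in> form_domain J'"
  then obtain g where f: "f \<in> L2" and g: "\<And>n. g n \<in> C1_compact_support"
    and lim: "(\<lambda>n. form1 J' (\<lambda>x. f x - g n x)) \<longlonglongrightarrow> 0"
    by (rule form_domainE) (rule that)
  have "(\<lambda>n. form1 J (\<lambda>x. f x - g n x)) \<longlonglongrightarrow> 0"
  proof (rule tendsto_sandwich[OF _ _ tendsto_const lim])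
    show "\<forall>\<^sub>F n in sequentially. form1 J (\<lambda>x. f x - g n x) \<le> form1 J' (\<lambda>x. f x - g n x)"
      unfolding form1_def by (intro always_eventually allI add_right_mono form_mono assms)
  qed simp
  with f g show "f \<in> form_domain J" by (rule form_domainI)
qed

lemma form_domain_imp_L2: "f \<in> form_domain J \<Longrightarrow> f \<in> L2"
  by (simp add: form_domain_def)

lemma C1_compact_support_imp_form_domain:
  assumes "f \<in> C1_compact_support"
  shows "f \<in> form_domain J"
proof -
  have "form1 J (\<lambda>x. f x - f x) = 0" by (simp add: form1_def form_def)
  then have "(\<lambda>n::nat. form1 J (\<lambda>x. f x - f x)) \<longlonglongrightarrow> 0" by simp
  then show ?thesis
    using assms by (intro form_domainI[where g = "\<lambda>n. f"] C1_compact_support_imp_L2)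
qed

locale jump_kernel =
  fixes J :: "'a::euclidean_space \<Rightarrow> 'a \<Rightarrow> real"
  assumes kernel_measurable: "(\<lambda>z. J (fst z) (snd z)) \<in> borel_measurable lebesgue"
    and kernel_nonneg: "0 \<le> J x y"
begin

lemma increment_kernel_measurable:
  "f \<in> borel_measurable lebesgue \<Longrightarrow> increment f \<in> borel_measurable (kernel_measure J)"
  using increment_measurable by (simp add: kernel_measure_def)

lemma form_eq_nn_integral:
  assumes "f \<in> borel_measurable lebesgue"
  shows "form J f = (\<integral>\<^sup>+ z. ennreal ((increment f z)\<^sup>2) \<partial>kernel_measure J)"
proof -
  note [measurable] = increment_measurable[OF assms] kernel_measurable
  have "(\<integral>\<^sup>+ z. ennreal ((increment f z)\<^sup>2) \<partial>kernel_measure J) =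
      (\<integral>\<^sup>+ z. ennreal (J (fst z) (snd z)) * ennreal ((increment f z)\<^sup>2) \<partial>lebesgue)"
    unfolding kernel_measure_def by (rule nn_integral_density) measurable
  then show ?thesis
    by (simp add: form_def increment_def kernel_nonneg ennreal_mult[symmetric] mult.commute)
qed

lemma form_finite_iff:
  assumes "f \<in> borel_measurable lebesgue"
  shows "form J f < \<infinity> \<longleftrightarrow> increment f \<in> square_integrable (kernel_measure J)"
  using assms
  by (simp add: form_eq_nn_integral square_integrable_iff_finite increment_kernel_measurable)

lemma form_eq_integral:
  assumes "f \<in> borel_measurable lebesgue" "form J f < \<infinity>"
  shows "form J f = ennreal (\<integral>z. (increment f z)\<^sup>2 \<partial>kernel_measure J)"
  using assms form_finite_iff form_eq_nn_integral nn_integral_square_eq by metis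

lemma form_linear_bound:
  assumes "f \<in> borel_measurable lebesgue" "g \<in> borel_measurable lebesgue"
    and "0 \<le> a" "0 \<le> b" "\<And>p q. (c * p + d * q)\<^sup>2 \<le> a * p\<^sup>2 + b * q\<^sup>2"
  shows "form J (\<lambda>x. c * f x + d * g x) \<le> ennreal a * form J f + ennreal b * form J g"
proof -
  have "increment (\<lambda>x. c * f x + d * g x) = (\<lambda>z. c * increment f z + d * increment g z)"
    by (auto simp: increment_def algebra_simps)
  moreover have "(\<lambda>x. c * f x + d * g x) \<in> borel_measurable lebesgue" using assms(1,2) by simp
  ultimately show ?thesis
    using assms by (simp add: form_eq_nn_integral nn_integral_square_linear_bound
        increment_kernel_measurable)
qed

lemma form1_linear_bound:
  assumes "f \<in> borel_measurable lebesgue" "g \<in> borel_measurable lebesgue"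
    and "0 \<le> a" "0 \<le> b" "\<And>p q. (c * p + d * q)\<^sup>2 \<le> a * p\<^sup>2 + b * q\<^sup>2"
  shows "form1 J (\<lambda>x. c * f x + d * g x) \<le> ennreal a * form1 J f + ennreal b * form1 J g"
proof -
  have "form1 J (\<lambda>x. c * f x + d * g x) \<le> (ennreal a * form J f + ennreal b * form J g) +
      (ennreal a * (\<integral>\<^sup>+ x. ennreal ((f x)\<^sup>2) \<partial>lebesgue) + ennreal b * (\<integral>\<^sup>+ x. ennreal ((g x)\<^sup>2) \<partial>lebesgue))"
    unfolding form1_def
    by (intro add_mono form_linear_bound nn_integral_square_linear_bound assms)
  then show ?thesis by (simp add: form1_def distrib_left add_ac)
qed

lemma form_domain_convex:
  assumes f: "f \<in> form_domain J" and g: "g \<in> form_domain J" and t: "0 \<le> t" "t \<le> 1"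
  shows "(\<lambda>x. (1 - t) * f x + t * g x) \<in> form_domain J"
proof -
  obtain fn where f2: "f \<in> L2" and fn: "\<And>n. fn n \<in> C1_compact_support"
    and flim: "(\<lambda>n. form1 J (\<lambda>x. f x - fn n x)) \<longlonglongrightarrow> 0"
    using f by (rule form_domainE) (rule that)
  obtain gn where g2: "g \<in> L2" and gn: "\<And>n. gn n \<in> C1_compact_support"
    and glim: "(\<lambda>n. form1 J (\<lambda>x. g x - gn n x)) \<longlonglongrightarrow> 0"
    using g by (rule form_domainE) (rule that)
  have m: "(\<lambda>x. f x - fn n x) \<in> borel_measurable lebesgue"
    "(\<lambda>x. g x - gn n x) \<in> borel_measurable lebesgue" for n
    by (intro borel_measurable_diff L2_measurable C1_compact_support_imp_L2 f2 g2 fn gn)+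
  have lim: "(\<lambda>n. form1 J (\<lambda>x. ((1 - t) * f x + t * g x) - ((1 - t) * fn n x + t * gn n x))) \<longlonglongrightarrow> 0"
  proof (rule tendsto_sandwich[OF _ _ tendsto_const])
    have "form1 J (\<lambda>x. ((1 - t) * f x + t * g x) - ((1 - t) * fn n x + t * gn n x)) \<le>
        ennreal (1 - t) * form1 J (\<lambda>x. f x - fn n x) + ennreal t * form1 J (\<lambda>x. g x - gn n x)" for n
    proof -
      have "(\<lambda>x. ((1 - t) * f x + t * g x) - ((1 - t) * fn n x + t * gn n x)) =
          (\<lambda>x. (1 - t) * (f x - fn n x) + t * (g x - gn n x))"
        by (auto simp: algebra_simps)
      then show ?thesis
        using form1_linear_bound[OF m(1)[of n] m(2)[of n] _ _ convex_combination_square_le[OF t]] t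
        by simp
    qed
    then show "\<forall>\<^sub>F n in sequentially.
        form1 J (\<lambda>x. ((1 - t) * f x + t * g x) - ((1 - t) * fn n x + t * gn n x)) \<le>
        ennreal (1 - t) * form1 J (\<lambda>x. f x - fn n x) + ennreal t * form1 J (\<lambda>x. g x - gn n x)"
      by simp
    have "(\<lambda>n. ennreal (1 - t) * form1 J (\<lambda>x. f x - fn n x) + ennreal t * form1 J (\<lambda>x. g x - gn n x))
        \<longlonglongrightarrow> ennreal (1 - t) * 0 + ennreal t * 0"
      by (intro tendsto_add tendsto_mult_ennreal tendsto_const flim glim) auto
    then show "(\<lambda>n. ennreal (1 - t) * form1 J (\<lambda>x. f x - fn n x) + ennreal t * form1 J (\<lambda>x. g x - gn n x))
        \<longlonglongrightarrow> 0" by simp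
  qed simp
  have core: "(\<lambda>x. (1 - t) * fn n x + t * gn n x) \<in> C1_compact_support" for n
    by (intro C1_compact_support_linear fn gn)
  have L2: "(\<lambda>x. (1 - t) * f x + t * g x) \<in> L2"
    using f2 g2 unfolding L2_eq_square_integrable
    by (intro square_integrable_add square_integrable_scale)
  from L2 core lim show ?thesis by (rule form_domainI)
qed

lemma form_domain_closed:
  assumes u: "u \<in> L2" and w: "\<And>n. w n \<in> form_domain J"
    and lim: "(\<lambda>n. form1 J (\<lambda>x. u x - w n x)) \<longlonglongrightarrow> 0"
  shows "u \<in> form_domain J"
proof -
  have "\<exists>g. g \<in> C1_compact_support \<and> form1 J (\<lambda>x. w n x - g x) < ennreal (1 / real (Suc n))" for n
  proof -
    obtain g where "w n \<in> L2" and g: "\<And>k. g k \<in> C1_compact_support"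
      and glim: "(\<lambda>k. form1 J (\<lambda>x. w n x - g k x)) \<longlonglongrightarrow> 0"
      using w[of n] by (rule form_domainE) (rule that)
    have "\<forall>\<^sub>F k in sequentially. form1 J (\<lambda>x. w n x - g k x) < ennreal (1 / real (Suc n))"
      using glim by (rule order_tendstoD(2)) simp
    then show ?thesis using g eventually_happens'[OF sequentially_bot] by blast
  qed
  then obtain g where g: "\<And>n. g n \<in> C1_compact_support"
    and glt: "\<And>n. form1 J (\<lambda>x. w n x - g n x) < ennreal (1 / real (Suc n))"
    by metis
  have m: "(\<lambda>x. u x - w n x) \<in> borel_measurable lebesgue"
    "(\<lambda>x. w n x - g n x) \<in> borel_measurable lebesgue" for n
    by (intro borel_measurable_diff L2_measurable u form_domain_imp_L2[OF w]
        C1_compact_support_imp_L2[OF g])+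
  have "(\<lambda>n. form1 J (\<lambda>x. u x - g n x)) \<longlonglongrightarrow> 0"
  proof (rule tendsto_sandwich[OF _ _ tendsto_const])
    have "form1 J (\<lambda>x. u x - g n x) \<le>
        ennreal 2 * form1 J (\<lambda>x. u x - w n x) + ennreal 2 * ennreal (1 / real (Suc n))" for n
    proof -
      have "form1 J (\<lambda>x. u x - g n x) \<le>
          ennreal 2 * form1 J (\<lambda>x. u x - w n x) + ennreal 2 * form1 J (\<lambda>x. w n x - g n x)"
        using form1_linear_bound[OF m(1)[of n] m(2)[of n] _ _ square_add_le] by simp
      also have "\<dots> \<le> ennreal 2 * form1 J (\<lambda>x. u x - w n x) + ennreal 2 * ennreal (1 / real (Suc n))"
        by (intro add_left_mono mult_left_mono less_imp_le glt) simp
      finally show ?thesis .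
    qed
    then show "\<forall>\<^sub>F n in sequentially. form1 J (\<lambda>x. u x - g n x) \<le>
        ennreal 2 * form1 J (\<lambda>x. u x - w n x) + ennreal 2 * ennreal (1 / real (Suc n))"
      by simp
    have "(\<lambda>n. ennreal (1 / real (Suc n))) \<longlonglongrightarrow> ennreal 0"
      by (intro tendsto_ennrealI LIMSEQ_Suc[OF lim_1_over_n])
    then have "(\<lambda>n. ennreal 2 * form1 J (\<lambda>x. u x - w n x) + ennreal 2 * ennreal (1 / real (Suc n)))
        \<longlonglongrightarrow> ennreal 2 * 0 + ennreal 2 * 0"
      by (intro tendsto_add tendsto_mult_ennreal tendsto_const lim) auto
    then show "(\<lambda>n. ennreal 2 * form1 J (\<lambda>x. u x - w n x) + ennreal 2 * ennreal (1 / real (Suc n)))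
        \<longlonglongrightarrow> 0" by simp
  qed simp
  with u g show ?thesis by (rule form_domainI)
qed

text \<open>Almost everywhere convergence on the space carries over to increments on the product since
  both projections pull null sets back to null sets.\<close>

lemma form_fatou:
  assumes f: "\<And>k. f k \<in> borel_measurable lebesgue" and u: "u \<in> borel_measurable lebesgue"
    and lim: "AE x in lebesgue. (\<lambda>k. f k x) \<longlonglongrightarrow> u x"
    and bound: "\<forall>\<^sub>F k in sequentially. form J (f k) \<le> c"
  shows "form J u \<le> c"
proof -
  have "AE z in (lebesgue :: ('a \<times> 'a) measure). (\<lambda>k. increment (f k) z) \<longlonglongrightarrow> increment u z"
    using AE_lebesgue_fst[OF lim] AE_lebesgue_snd[OF lim]
    by eventually_elim (auto simp: increment_def intro: tendsto_diff)
  then have "AE z in kernel_measure J. (\<lambda>k. increment (f k) z) \<longlonglongrightarrow> increment u z"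
    unfolding kernel_measure_def using kernel_measurable
    by (subst AE_density) (auto elim: eventually_mono)
  then show ?thesis
    unfolding form_eq_nn_integral[OF u]
    using bound unfolding form_eq_nn_integral[OF f]
    by (intro nn_integral_square_fatou[where f = "\<lambda>k. increment (f k)"] increment_kernel_measurable f)
qed

text \<open>Weak lower semicontinuity, including membership of the limit in the domain. Mazur's
  theorem gives points of the convex sublevel set near \<open>u\<close>. Minimizing the form over those points
  at distance at most \<open>1 / sqrt (n + 1)\<close> from \<open>u\<close> gives a sequence that is Cauchy for the form
  and converges to \<open>u\<close> in \<open>L\<^sup>2\<close>; hence it converges in the norm that defines the domain.\<close>

lemma form_weakly_lower_semicontinuous:
  assumes weak: "L2_weak_conv us u"
    and c: "c < \<infinity>"
    and freq: "\<exists>\<^sub>F n in sequentially. us n \<in> form_domain J \<and> form J (us n) \<le> c"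
  shows "u \<in> form_domain J" and "form J u \<le> c"
proof -
  have u: "u \<in> L2" using weak by (simp add: L2_weak_conv_def)
  then have u2: "u \<in> square_integrable lebesgue" by (simp add: L2_eq_square_integrable)
  define K where "K = {f \<in> form_domain J. form J f \<le> c}"
  have K_L2: "f \<in> square_integrable lebesgue" and K_m: "f \<in> borel_measurable lebesgue"
    if "f \<in> K" for f
    using that form_domain_imp_L2[of f J]
    by (auto simp: K_def L2_eq_square_integrable square_integrable_def)
  have K_fin: "form J f < \<infinity>" if "f \<in> K" for f
    using that c by (auto simp: K_def intro: le_less_trans)
  have K_inc: "increment f \<in> square_integrable (kernel_measure J)" if "f \<in> K" for f
    using K_fin[OF that] form_finite_iff[OF K_m[OF that]] by blast
  have K_convex: "(\<lambda>x. (1 - t) * f x + t * g x) \<in> K"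
    if fg: "f \<in> K" "g \<in> K" and t: "0 \<le> t" "t \<le> 1" for f g t
  proof -
    have "form J (\<lambda>x. (1 - t) * f x + t * g x) \<le> ennreal (1 - t) * form J f + ennreal t * form J g"
      using t by (intro form_linear_bound K_m fg convex_combination_square_le) auto
    also have "\<dots> \<le> ennreal (1 - t) * c + ennreal t * c"
      using fg by (intro add_mono mult_left_mono) (auto simp: K_def)
    also have "\<dots> = c"
      using t by (simp add: distrib_right[symmetric] ennreal_plus[symmetric] del: ennreal_plus)
    finally show ?thesis using fg t form_domain_convex by (simp add: K_def)
  qed
  have K_mid: "(\<lambda>x. (f x + g x) / 2) \<in> K" if "f \<in> K" "g \<in> K" for f g
    using K_convex[OF that, of "1/2"] by (simp add: add_divide_distrib)
  obtain v where v: "\<And>n. v n \<in> K" and vlim: "(\<lambda>n. \<integral>x. (v n x - u x)\<^sup>2 \<partial>lebesgue) \<longlonglongrightarrow> 0"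
  proof (rule mazur_square_integrable[where M = lebesgue and K = K and u = u and us = us])
    show "K \<subseteq> square_integrable lebesgue" using K_L2 by blast
    show "\<exists>\<^sub>F n in sequentially. us n \<in> K" using freq by (simp add: K_def)
    show "(\<lambda>n. \<integral>x. us n x * v x \<partial>lebesgue) \<longlonglongrightarrow> (\<integral>x. u x * v x \<partial>lebesgue)"
      if "v \<in> square_integrable lebesgue" for v
      using weak that by (simp add: L2_weak_conv_def L2_eq_square_integrable)
  qed (use K_convex u2 in auto)
  define Kn where "Kn n = {f \<in> K. (\<integral>x. (f x - u x)\<^sup>2 \<partial>lebesgue) \<le> 1 / real (Suc n)}" for n
  let ?q = "\<lambda>f. \<integral>z. (increment f z)\<^sup>2 \<partial>kernel_measure J"
  let ?d = "\<lambda>f g. \<integral>z. (increment f z - increment g z)\<^sup>2 \<partial>kernel_measure J"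
  obtain w where w: "\<And>n. w n \<in> Kn n"
    and wcau: "\<And>e. 0 < e \<Longrightarrow> \<exists>N. \<forall>m\<ge>N. \<forall>n\<ge>N. ?d (w m) (w n) < e"
  proof (rule minimizing_sequence_Cauchy[where K = Kn and q = ?q and L = "enn2real c"
        and mid = "\<lambda>f g x. (f x + g x) / 2" and d = ?d])
    show "decseq Kn"
    proof (rule antimonoI)
      fix m n :: nat assume "m \<le> n"
      then have "1 / real (Suc n) \<le> 1 / real (Suc m)" by (simp add: frac_le)
      then show "Kn n \<subseteq> Kn m" unfolding Kn_def by auto
    qed
    show "\<exists>f\<in>Kn n. ?q f \<le> enn2real c" for n
    proof -
      have "\<forall>\<^sub>F k in sequentially. (\<integral>x. (v k x - u x)\<^sup>2 \<partial>lebesgue) < 1 / real (Suc n)"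
        using vlim by (rule order_tendstoD(2)) simp
      then obtain k where k: "(\<integral>x. (v k x - u x)\<^sup>2 \<partial>lebesgue) < 1 / real (Suc n)"
        using eventually_happens'[OF sequentially_bot] by blast
      have "ennreal (?q (v k)) \<le> c"
        using form_eq_integral[OF K_m K_fin, OF v v, of k] v[of k] by (simp add: K_def)
      then have "?q (v k) \<le> enn2real c"
        using c enn2real_mono[of "ennreal (?q (v k))" c] by simp
      then show ?thesis using k v[of k] by (auto simp: Kn_def intro!: bexI[of _ "v k"])
    qed
    show "(\<lambda>x. (f x + g x) / 2) \<in> Kn n" if fg: "f \<in> Kn n" "g \<in> Kn n" for n f g
    proof -
      have K: "f \<in> K" "g \<in> K" using fg by (auto simp: Kn_def)
      have mid_eq: "((f x - u x) + (g x - u x)) / 2 = (f x + g x) / 2 - u x" for x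
        by (simp add: field_simps)
      have "(\<integral>x. ((f x - u x) - (g x - u x))\<^sup>2 \<partial>lebesgue) +
          4 * (\<integral>x. (((f x - u x) + (g x - u x)) / 2)\<^sup>2 \<partial>lebesgue) =
          2 * (\<integral>x. (f x - u x)\<^sup>2 \<partial>lebesgue) + 2 * (\<integral>x. (g x - u x)\<^sup>2 \<partial>lebesgue)"
        by (intro integral_parallelogram_midpoint square_integrable_diff K_L2 K u2)
      then have "(\<integral>x. ((f x - u x) - (g x - u x))\<^sup>2 \<partial>lebesgue) +
          4 * (\<integral>x. ((f x + g x) / 2 - u x)\<^sup>2 \<partial>lebesgue) =
          2 * (\<integral>x. (f x - u x)\<^sup>2 \<partial>lebesgue) + 2 * (\<integral>x. (g x - u x)\<^sup>2 \<partial>lebesgue)"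
        unfolding mid_eq .
      moreover have "0 \<le> (\<integral>x. ((f x - u x) - (g x - u x))\<^sup>2 \<partial>lebesgue)"
        by (rule integral_nonneg_AE) simp
      moreover have "(\<integral>x. (f x - u x)\<^sup>2 \<partial>lebesgue) \<le> 1 / real (Suc n)"
        "(\<integral>x. (g x - u x)\<^sup>2 \<partial>lebesgue) \<le> 1 / real (Suc n)"
        using fg by (auto simp: Kn_def)
      ultimately have "(\<integral>x. ((f x + g x) / 2 - u x)\<^sup>2 \<partial>lebesgue) \<le> 1 / real (Suc n)"
        by argo
      then show ?thesis using K_mid[OF K] by (simp add: Kn_def)
    qed
    show "?d f g + 4 * ?q (\<lambda>x. (f x + g x) / 2) = 2 * ?q f + 2 * ?q g"
      if fg: "f \<in> Kn 0" "g \<in> Kn 0" for f g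
    proof -
      have "increment (\<lambda>x. (f x + g x) / 2) = (\<lambda>z. (increment f z + increment g z) / 2)"
        by (auto simp: increment_def field_simps)
      then show ?thesis
        using integral_parallelogram_midpoint[OF K_inc K_inc, of f g] fg by (simp add: Kn_def)
    qed
  qed auto
  have wK: "w n \<in> K" and w_near: "(\<integral>x. (w n x - u x)\<^sup>2 \<partial>lebesgue) \<le> 1 / real (Suc n)" for n
    using w[of n] by (auto simp: Kn_def)
  have w_lim: "(\<lambda>n. \<integral>x. (w n x - u x)\<^sup>2 \<partial>lebesgue) \<longlonglongrightarrow> 0"
    by (rule tendsto_sandwich[OF _ _ tendsto_const LIMSEQ_Suc[OF lim_1_over_n]]) (use w_near in auto)
  obtain r :: "nat \<Rightarrow> nat"
    where r: "strict_mono r" "AE x in lebesgue. (\<lambda>k. w (r k) x) \<longlonglongrightarrow> u x"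
    using tendsto_square_integral_AE_subseq[OF K_L2[OF wK] u2 w_lim] by blast
  have um: "u \<in> borel_measurable lebesgue" using u by (rule L2_measurable)
  show "form J u \<le> c"
    using r(2) wK by (intro form_fatou[of "\<lambda>k. w (r k)"] K_m um) (auto simp: K_def)
  have form_lim: "(\<lambda>n. form J (\<lambda>x. u x - w n x)) \<longlonglongrightarrow> 0"
  proof (rule tendsto_zero_ennreal)
    fix e :: real assume e: "0 < e"
    then obtain N where N: "\<And>m n. N \<le> m \<Longrightarrow> N \<le> n \<Longrightarrow> ?d (w m) (w n) < e / 2"
      using wcau[of "e / 2"] by auto
    have le: "form J (\<lambda>x. u x - w n x) \<le> ennreal (e / 2)" if n: "N \<le> n" for n
    proof (rule form_fatou[of "\<lambda>k x. w (r k) x - w n x"])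
      show "AE x in lebesgue. (\<lambda>k. w (r k) x - w n x) \<longlonglongrightarrow> u x - w n x"
        using r(2) by eventually_elim (intro tendsto_intros)
      show "\<forall>\<^sub>F k in sequentially. form J (\<lambda>x. w (r k) x - w n x) \<le> ennreal (e / 2)"
        using eventually_ge_at_top[of N]
      proof eventually_elim
        case (elim k)
        then have rk: "N \<le> r k" using strict_mono_imp_increasing[OF r(1), of k] by linarith
        have "increment (\<lambda>x. w (r k) x - w n x) = (\<lambda>z. increment (w (r k)) z - increment (w n) z)"
          by (auto simp: increment_def)
        moreover have "(\<lambda>x. w (r k) x - w n x) \<in> borel_measurable lebesgue"
          using K_m[OF wK] by simp
        ultimately have "form J (\<lambda>x. w (r k) x - w n x) = ennreal (?d (w (r k)) (w n))"
          by (simp add: form_eq_nn_integral nn_integral_square_eq square_integrable_diff K_inc wK)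
        then show ?case using N[OF rk n] by (simp add: ennreal_leI)
      qed
    qed (use K_m[OF wK] um in auto)
    show "\<forall>\<^sub>F n in sequentially. form J (\<lambda>x. u x - w n x) < ennreal e"
      using eventually_ge_at_top[of N]
    proof eventually_elim
      case (elim n)
      have "ennreal (e / 2) < ennreal e" using e by (intro ennreal_lessI) auto
      with le[OF elim] show ?case by (rule le_less_trans)
    qed
  qed
  have "(\<integral>\<^sup>+ x. ennreal ((u x - w n x)\<^sup>2) \<partial>lebesgue) = ennreal (\<integral>x. (w n x - u x)\<^sup>2 \<partial>lebesgue)" for n
    using nn_integral_square_eq[OF square_integrable_diff[OF u2 K_L2[OF wK]]]
    by (simp add: power2_commute[of "u _"])
  then have "(\<lambda>n. \<integral>\<^sup>+ x. ennreal ((u x - w n x)\<^sup>2) \<partial>lebesgue) \<longlonglongrightarrow> 0"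
    using tendsto_ennrealI[OF w_lim] by simp
  from tendsto_add[OF form_lim this] have lim: "(\<lambda>n. form1 J (\<lambda>x. u x - w n x)) \<longlonglongrightarrow> 0"
    by (simp add: form1_def)
  have "w n \<in> form_domain J" for n using wK[of n] by (simp add: K_def)
  from u this lim show "u \<in> form_domain J" by (rule form_domain_closed)
qed

end

text \<open>The core is dense for the form norm, so the form of the approximant exceeds that of \<open>u\<close> by
  little; this is the only property of the domain that recovery sequences use.\<close>

lemma (in jump_kernel) core_approximation:
  assumes u: "u \<in> form_domain J" and fin: "form J u < \<infinity>" and \<delta>: "0 < \<delta>"
  obtains h where "h \<in> C1_compact_support" "form J h \<le> form J u + ennreal \<delta>"
    "(\<integral>x. (h x - u x)\<^sup>2 \<partial>lebesgue) < \<delta>"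
proof -
  obtain g where u2: "u \<in> L2" and g: "\<And>n. g n \<in> C1_compact_support"
    and lim: "(\<lambda>n. form1 J (\<lambda>x. u x - g n x)) \<longlonglongrightarrow> 0"
    using u by (rule form_domainE) (rule that)
  obtain a where a: "0 \<le> a" "form J u = ennreal a"
    using fin by (cases "form J u") auto
  \<comment> \<open>The choice of \<open>e\<close> spends half of \<open>\<delta>\<close> on the factor \<open>1 + e\<close> in front of the form of \<open>u\<close>;
    that of \<open>r\<close> spends the other half on the form of \<open>u - h\<close>.\<close>
  define e where "e = \<delta> / (2 * (a + 1))"
  have e: "0 < e" using a \<delta> by (simp add: e_def)
  have "e * a \<le> e * (a + 1)" using e by (intro mult_left_mono) auto
  also have "\<dots> = \<delta> / 2"
  proof -
    have "a + 1 \<noteq> 0" using a by linarith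
    then show ?thesis unfolding e_def by (simp add: divide_simps)
  qed
  finally have ea: "e * a \<le> \<delta> / 2" .
  define r where "r = min \<delta> ((\<delta> / 2) / (1 + 1 / e))"
  have e1: "0 < 1 + 1 / e" using e by (simp add: add_pos_pos)
  have r: "0 < r" "r \<le> \<delta>" using \<delta> e1 by (auto simp: r_def)
  have "(1 + 1 / e) * r \<le> (1 + 1 / e) * ((\<delta> / 2) / (1 + 1 / e))"
    using e1 by (intro mult_left_mono) (auto simp: r_def)
  also have "\<dots> = \<delta> / 2"
    using e1 by (metis less_irrefl nonzero_mult_div_cancel_left times_divide_eq_right)
  finally have re: "(1 + 1 / e) * r \<le> \<delta> / 2" .
  have "\<forall>\<^sub>F n in sequentially. form1 J (\<lambda>x. u x - g n x) < ennreal r"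
    using lim by (rule order_tendstoD(2)) (use r in simp)
  then obtain n where n: "form1 J (\<lambda>x. u x - g n x) < ennreal r"
    using eventually_happens'[OF sequentially_bot] by blast
  let ?h = "g n"
  have um: "u \<in> borel_measurable lebesgue" using u2 by (rule L2_measurable)
  have hL2: "?h \<in> L2" using g by (rule C1_compact_support_imp_L2)
  have dm: "(\<lambda>x. u x - ?h x) \<in> borel_measurable lebesgue"
    by (intro borel_measurable_diff um L2_measurable hL2)
  have "form J (\<lambda>x. u x - ?h x) \<le> form1 J (\<lambda>x. u x - ?h x)"
    "(\<integral>\<^sup>+ x. ennreal ((u x - ?h x)\<^sup>2) \<partial>lebesgue) \<le> form1 J (\<lambda>x. u x - ?h x)"
    by (simp_all add: form1_def)
  then have split: "form J (\<lambda>x. u x - ?h x) \<le> ennreal r"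
    "(\<integral>\<^sup>+ x. ennreal ((u x - ?h x)\<^sup>2) \<partial>lebesgue) < ennreal r"
    using n by (blast intro: le_less_trans less_imp_le)+
  have weighted: "(1 * p + (- 1) * q)\<^sup>2 \<le> (1 + e) * p\<^sup>2 + (1 + 1 / e) * q\<^sup>2" for p q :: real
    using square_le_weighted[OF e, of "p - q" p] by simp
  have "form J (\<lambda>x. 1 * u x + (- 1) * (u x - ?h x)) \<le>
      ennreal (1 + e) * form J u + ennreal (1 + 1 / e) * form J (\<lambda>x. u x - ?h x)"
    by (rule form_linear_bound[OF um dm _ _ weighted]) (use e in auto)
  also have "\<dots> \<le> ennreal (1 + e) * ennreal a + ennreal (1 + 1 / e) * ennreal r"
    using split(1) a(2) by (intro add_mono mult_left_mono) auto
  also have "\<dots> = ennreal ((1 + e) * a + (1 + 1 / e) * r)"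
    using e a r e1 by (simp add: ennreal_mult[symmetric] ennreal_plus[symmetric] del: ennreal_plus)
  also have "\<dots> \<le> ennreal (a + \<delta>)"
  proof (rule ennreal_leI)
    have "(1 + e) * a = a + e * a" by (simp add: distrib_right)
    then show "(1 + e) * a + (1 + 1 / e) * r \<le> a + \<delta>" using ea re by linarith
  qed
  also have "\<dots> = form J u + ennreal \<delta>" using a \<delta> by simp
  finally have 1: "form J ?h \<le> form J u + ennreal \<delta>" by simp
  have "ennreal (\<integral>x. (u x - ?h x)\<^sup>2 \<partial>lebesgue) < ennreal r"
    using split(2) nn_integral_square_eq[of "\<lambda>x. u x - ?h x" lebesgue] u2 hL2
    by (simp add: L2_eq_square_integrable square_integrable_diff)
  then have "(\<integral>x. (u x - ?h x)\<^sup>2 \<partial>lebesgue) < r" using r by (simp add: ennreal_less_iff)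
  then have "(\<integral>x. (?h x - u x)\<^sup>2 \<partial>lebesgue) < \<delta>" using r by (simp add: power2_commute)
  with g 1 show thesis by (rule that)
qed

section \<open>The energy of small jumps\<close>

text \<open>Dyadic decomposition: on the shell \<open>q / 2 < \<bar>h\<bar> \<le> q\<close> with \<open>q = 2\<^sup>-\<^sup>k\<close> the integrand is at most
  \<open>q\<^sup>s / (q / 2)\<^sup>d\<close>, while the ball of radius \<open>q\<close> has volume proportional to \<open>q\<^sup>d\<close>. The remaining
  series in \<open>q\<^sup>s\<close> is geometric.\<close>

lemma nn_integral_norm_powr_cball_finite:
  fixes s :: real
  assumes s: "0 < s"
  shows "(\<integral>\<^sup>+ h. ennreal (norm h powr (s - real DIM('a))) * indicator (cball 0 1) h
    \<partial>(lborel :: 'a::euclidean_space measure)) < \<infinity>"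
proof -
  define d where "d = DIM('a)"
  define q :: "nat \<Rightarrow> real" where "q k = (1/2)^k" for k
  define c where "c k = q k powr s / (q k / 2)^d" for k
  have q: "0 < q k" for k by (simp add: q_def)
  have c0: "0 \<le> c k" for k using q[of k] by (simp add: c_def)
  have pointwise: "ennreal (norm h powr (s - real d)) * indicator (cball 0 1) h \<le>
      (\<Sum>k. ennreal (c k) * indicator (cball 0 (q k)) h)" for h :: 'a
  proof (cases "h = 0 \<or> 1 < norm h")
    case True
    then show ?thesis by auto
  next
    case False
    then have h: "0 < norm h" "norm h \<le> 1" by auto
    have ex: "\<exists>n. (1/2)^n < norm h" using h real_arch_pow_inv[of "norm h" "1/2"] by simp
    define n where "n = (LEAST n. (1/2)^n < norm h)"
    have n: "(1/2)^n < norm h" unfolding n_def using ex by (rule LeastI_ex)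
    have "n \<noteq> 0" using n h by (intro notI) simp
    then obtain k where k: "n = Suc k" by (cases n) auto
    have lower: "q k / 2 < norm h" using n k by (simp add: q_def)
    have "\<not> (1/2)^k < norm h" using not_less_Least[of k "\<lambda>n. (1/2)^n < norm h"] k n_def by simp
    then have upper: "norm h \<le> q k" by (simp add: q_def)
    have "norm h powr (s - real d) = norm h powr s / norm h ^ d"
      using h by (simp add: powr_diff powr_realpow)
    also have "\<dots> \<le> c k"
      unfolding c_def using lower upper h s q[of k]
      by (intro frac_le powr_mono2 power_mono) auto
    finally have "ennreal (norm h powr (s - real d)) * indicator (cball 0 1) h \<le>
        ennreal (c k) * indicator (cball 0 (q k)) h"
      using upper by (auto simp: indicator_def ennreal_leI)
    also have "\<dots> \<le> (\<Sum>k. ennreal (c k) * indicator (cball 0 (q k)) h)"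
    proof -
      define F where "F k = ennreal (c k) * indicator (cball 0 (q k)) h" for k
      have "sum F {k} \<le> suminf F" by (rule sum_le_suminf) auto
      then have "F k \<le> suminf F" by simp
      then show ?thesis unfolding F_def .
    qed
    finally show ?thesis .
  qed
  have [measurable]: "cball (0::'a) (q k) \<in> sets borel" for k by simp
  have "(\<integral>\<^sup>+ h. ennreal (norm h powr (s - real d)) * indicator (cball 0 1) h \<partial>(lborel :: 'a measure)) \<le>
      (\<integral>\<^sup>+ h. (\<Sum>k. ennreal (c k) * indicator (cball 0 (q k)) h) \<partial>(lborel :: 'a measure))"
    by (rule nn_integral_mono) (rule pointwise)
  also have "\<dots> = (\<Sum>k. \<integral>\<^sup>+ h. ennreal (c k) * indicator (cball 0 (q k)) h \<partial>(lborel :: 'a measure))"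
    by (rule nn_integral_suminf) measurable
  also have "\<dots> = (\<Sum>k. ennreal (2^d * unit_ball_vol d * ((1/2) powr s)^k))"
  proof (rule suminf_cong)
    fix k
    have "(\<integral>\<^sup>+ h. ennreal (c k) * indicator (cball 0 (q k)) h \<partial>(lborel :: 'a measure)) =
        ennreal (c k) * emeasure lborel (cball (0::'a) (q k))"
      by (rule nn_integral_cmult_indicator) simp
    also have "\<dots> = ennreal (c k * (unit_ball_vol d * q k ^ d))"
      using q[of k] c0[of k] by (simp add: emeasure_cball ennreal_mult[symmetric] d_def)
    also have "c k * (unit_ball_vol d * q k ^ d) = 2^d * unit_ball_vol d * q k powr s"
      using q[of k] by (simp add: c_def power_divide field_simps)
    also have "q k powr s = ((1/2) powr s)^k"
      unfolding q_def by (simp add: powr_powr powr_realpow[symmetric] mult.commute)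
    finally show "(\<integral>\<^sup>+ h. ennreal (c k) * indicator (cball 0 (q k)) h \<partial>(lborel :: 'a measure)) =
        ennreal (2^d * unit_ball_vol d * ((1/2) powr s)^k)" .
  qed
  also have "\<dots> = ennreal (\<Sum>k. 2^d * unit_ball_vol d * ((1/2) powr s)^k)"
  proof (rule suminf_ennreal2)
    have "(1/2::real) powr s < 1 powr s" using s by (intro powr_less_mono2) auto
    then show "summable (\<lambda>k. 2^d * unit_ball_vol d * ((1/2) powr s)^k)"
      by (intro summable_mult summable_geometric) simp
  qed simp
  also have "\<dots> < \<infinity>" by simp
  finally show ?thesis by (simp add: d_def)
qed

lemma C1_compact_support_increment_bound:
  assumes "g \<in> C1_compact_support"
  obtains C R :: real where "0 \<le> C"
    "\<And>x y. norm (y - x) \<le> 1 \<Longrightarrow> (g y - g x)\<^sup>2 \<le> C * (norm (y - x))\<^sup>2 * indicator (cball 0 R) x"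
proof -
  obtain g' where g': "\<And>x. (g has_derivative blinfun_apply (g' x)) (at x)"
    and cont: "continuous_on UNIV g'" and supp: "compact (closure {x. g x \<noteq> 0})"
    using assms by (auto simp: C1_compact_support_def)
  obtain S where S: "0 < S" "\<And>x. x \<in> closure {x. g x \<noteq> 0} \<Longrightarrow> norm x \<le> S"
    using compact_imp_bounded[OF supp] by (auto simp: bounded_pos)
  have zero: "g x = 0" if "S < norm x" for x
    using S(2)[of x] closure_subset[of "{x. g x \<noteq> 0}"] that by force
  \<comment> \<open>Let \<open>norm (y - x) \<le> 1\<close>. If \<open>x\<close> is outside the ball of radius \<open>S + 1\<close>, then both \<open>x\<close> and \<open>y\<close> are outside the support;
    otherwise both lie in the ball of radius \<open>S + 2\<close>, where the derivative is bounded.\<close>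
  have "compact (g' ` cball 0 (S + 2))"
    by (intro compact_continuous_image continuous_on_subset[OF cont]) auto
  then obtain B where B: "0 < B" "\<And>x. x \<in> cball 0 (S + 2) \<Longrightarrow> norm (g' x) \<le> B"
    using compact_imp_bounded by (force simp: bounded_pos)
  have lip: "norm (g y - g x) \<le> B * norm (y - x)"
    if "x \<in> cball 0 (S + 2)" "y \<in> cball 0 (S + 2)" for x y
  proof (rule differentiable_bound[where S = "cball 0 (S + 2)" and f' = "\<lambda>x. blinfun_apply (g' x)"])
    show "(g has_derivative blinfun_apply (g' x)) (at x within cball 0 (S + 2))" for x
      using g' by (rule has_derivative_at_withinI)
    show "onorm (blinfun_apply (g' x)) \<le> B" if "x \<in> cball 0 (S + 2)" for x
      using B(2)[OF that] by (simp add: norm_blinfun.rep_eq)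
  qed (use that in auto)
  show thesis
  proof (rule that[of "B\<^sup>2" "S + 1"])
    fix x y :: 'a assume xy: "norm (y - x) \<le> 1"
    have ny: "norm y \<le> norm x + 1" "norm x \<le> norm y + 1"
      using xy norm_triangle_sub[of y x] norm_triangle_sub[of x y] by (auto simp: norm_minus_commute)
    show "(g y - g x)\<^sup>2 \<le> B\<^sup>2 * (norm (y - x))\<^sup>2 * indicator (cball 0 (S + 1)) x"
    proof (cases "norm x \<le> S + 1")
      case True
      then have "\<bar>g y - g x\<bar> \<le> B * norm (y - x)" using lip[of x y] ny by simp
      then have "\<bar>g y - g x\<bar>\<^sup>2 \<le> (B * norm (y - x))\<^sup>2" by (intro power_mono) auto
      then show ?thesis using True by (simp add: power_mult_distrib)
    next
      case False
      then have "g x = 0" "g y = 0" using ny by (auto intro: zero)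
      then show ?thesis using False by simp
    qed
  qed (use S in auto)
qed

lemma nn_integral_lborel_translate:
  fixes \<phi> :: "'a::euclidean_space \<Rightarrow> ennreal"
  assumes [measurable]: "\<phi> \<in> borel_measurable borel"
  shows "(\<integral>\<^sup>+ y. \<phi> (y - x) \<partial>lborel) = (\<integral>\<^sup>+ h. \<phi> h \<partial>lborel)"
proof -
  have "(\<integral>\<^sup>+ h. \<phi> h \<partial>lborel) = (\<integral>\<^sup>+ h. \<phi> h \<partial>distr lborel borel ((+) (- x)))"
    by (simp add: lborel_distr_plus)
  also have "\<dots> = (\<integral>\<^sup>+ y. \<phi> (- x + y) \<partial>lborel)" by (subst nn_integral_distr) auto
  finally show ?thesis by simp
qed

lemma nn_integral_product_shift:
  fixes \<phi> :: "'a::euclidean_space \<Rightarrow> ennreal"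
  assumes [measurable]: "\<phi> \<in> borel_measurable borel"
  shows "(\<integral>\<^sup>+ z. indicator (cball 0 R) (fst z) * \<phi> (snd z - fst z) \<partial>(lborel :: ('a \<times> 'a) measure)) =
    emeasure lborel (cball (0::'a) R) * (\<integral>\<^sup>+ h. \<phi> h \<partial>lborel)"
proof -
  have [measurable]: "cball (0::'a) R \<in> sets borel" by simp
  have "(\<lambda>z. indicator (cball 0 R) (fst z) * \<phi> (snd z - fst z)) \<in>
      borel_measurable (lborel \<Otimes>\<^sub>M (lborel :: 'a measure))"
    by measurable
  then have "(\<integral>\<^sup>+ z. indicator (cball 0 R) (fst z) * \<phi> (snd z - fst z) \<partial>(lborel :: ('a \<times> 'a) measure)) =
      (\<integral>\<^sup>+ x. \<integral>\<^sup>+ y. indicator (cball 0 R) x * \<phi> (y - x) \<partial>lborel \<partial>lborel)"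
    by (simp add: lborel_prod[symmetric] lborel.nn_integral_fst[symmetric])
  also have "\<dots> = (\<integral>\<^sup>+ x. indicator (cball (0::'a) R) x * (\<integral>\<^sup>+ h. \<phi> h \<partial>lborel) \<partial>lborel)"
    by (intro nn_integral_cong) (simp add: nn_integral_cmult nn_integral_lborel_translate)
  also have "\<dots> = emeasure lborel (cball (0::'a) R) * (\<integral>\<^sup>+ h. \<phi> h \<partial>lborel)"
    by (simp add: nn_integral_multc)
  finally show ?thesis .
qed

text \<open>Replacing the kernel on jumps of length at most \<open>t\<close> costs little on the core. For a Lipschitz
  function the added integrand is of order \<open>\<bar>h\<bar>\<^bsup>2 - d - \<beta>\<^esup>\<close>, which is \<open>\<bar>h\<bar>\<^bsup>\<sigma>\<^esup> \<le> t\<^bsup>\<sigma>\<^esup>\<close> times the integrable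
  power \<open>\<bar>h\<bar>\<^bsup>\<sigma> - d\<^esup>\<close>, where \<open>\<sigma> = (2 - \<beta>) / 2\<close>.\<close>

lemma (in jump_kernel) form_J_xi_le:
  assumes g: "g \<in> C1_compact_support" and \<beta>: "\<beta> < 2" and \<kappa>: "0 < \<kappa>"
  obtains K where "0 \<le> K"
    "\<And>t. 0 < t \<Longrightarrow> t \<le> 1 \<Longrightarrow>
      form (J_xi \<kappa> \<beta> J t) g \<le> form J g + ennreal (K * t powr ((2 - \<beta>) / 2))"
proof -
  define \<sigma> where "\<sigma> = (2 - \<beta>) / 2"
  have \<sigma>: "0 < \<sigma>" "2 - \<beta> = \<sigma> + \<sigma>" using \<beta> by (auto simp: \<sigma>_def)
  obtain C R where C: "0 \<le> C"
    and bound: "\<And>x y. norm (y - x) \<le> 1 \<Longrightarrow>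
      (g y - g x)\<^sup>2 \<le> C * (norm (y - x))\<^sup>2 * indicator (cball 0 R) x"
    using C1_compact_support_increment_bound[OF g] by metis
  define \<phi> where "\<phi> h = ennreal (norm h powr (\<sigma> - real DIM('a))) * indicator (cball 0 1) h" for h :: 'a
  have [measurable]: "cball (0::'a) 1 \<in> sets borel" by simp
  have [measurable]: "\<phi> \<in> borel_measurable borel" unfolding \<phi>_def by measurable
  have "(\<integral>\<^sup>+ h. \<phi> h \<partial>lborel) < \<infinity>"
    unfolding \<phi>_def using \<sigma>(1) by (rule nn_integral_norm_powr_cball_finite)
  then have "emeasure lborel (cball (0::'a) R) * (\<integral>\<^sup>+ h. \<phi> h \<partial>lborel) < \<infinity>"
    using emeasure_lborel_cball_finite[of "0::'a" R] by (simp add: ennreal_mult_less_top)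
  then obtain I where I: "0 \<le> I"
    "emeasure lborel (cball (0::'a) R) * (\<integral>\<^sup>+ h. \<phi> h \<partial>lborel) = ennreal I"
    by (cases "emeasure lborel (cball (0::'a) R) * (\<integral>\<^sup>+ h. \<phi> h \<partial>lborel)") auto
  have [measurable]: "g \<in> borel_measurable lebesgue"
    using C1_compact_support_imp_L2[OF g] by (rule L2_measurable)
  have "form (J_xi \<kappa> \<beta> J t) g \<le> form J g + ennreal (C * \<kappa> * I * t powr \<sigma>)" if t: "0 < t" "t \<le> 1" for t
  proof -
    define \<psi> :: "'a \<times> 'a \<Rightarrow> ennreal" where
      "\<psi> z = ennreal (C * \<kappa> * t powr \<sigma>) * (indicator (cball 0 R) (fst z) * \<phi> (snd z - fst z))" for z
    have pointwise: "ennreal ((g (snd z) - g (fst z))\<^sup>2 * J_xi \<kappa> \<beta> J t (fst z) (snd z)) \<le>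
        ennreal ((g (snd z) - g (fst z))\<^sup>2 * J (fst z) (snd z)) + \<psi> z" for z
    proof (cases "norm (fst z - snd z) > t \<or> fst z = snd z")
      case True
      then show ?thesis by (auto simp: J_xi_def)
    next
      case False
      define x where "x = fst z"
      define y where "y = snd z"
      define r where "r = norm (y - x)"
      have r: "0 < r" "r \<le> t" "r \<le> 1" using False t by (auto simp: r_def x_def y_def norm_minus_commute)
      have rJ: "J_xi \<kappa> \<beta> J t x y = \<kappa> * r powr (- real DIM('a) - \<beta>)"
        using r by (simp add: J_xi_def r_def norm_minus_commute)
      have pow: "r\<^sup>2 * r powr (- real DIM('a) - \<beta>) = r powr \<sigma> * r powr (\<sigma> - real DIM('a))"
      proof -
        have "r\<^sup>2 = r powr 2" using r by (simp add: powr_numeral)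
        then have "r\<^sup>2 * r powr (- real DIM('a) - \<beta>) = r powr (2 + (- real DIM('a) - \<beta>))"
          by (simp only: powr_add)
        also have "2 + (- real DIM('a) - \<beta>) = \<sigma> + (\<sigma> - real DIM('a))" using \<sigma>(2) by simp
        finally show ?thesis by (simp only: powr_add)
      qed
      have "(g y - g x)\<^sup>2 * J_xi \<kappa> \<beta> J t x y \<le>
          (C * r\<^sup>2 * indicator (cball 0 R) x) * (\<kappa> * r powr (- real DIM('a) - \<beta>))"
        unfolding rJ using bound[of y x] r \<kappa> by (intro mult_right_mono) (auto simp: r_def)
      also have "\<dots> = C * \<kappa> * (r\<^sup>2 * r powr (- real DIM('a) - \<beta>)) * indicator (cball 0 R) x"
        by (simp only: mult_ac)
      also have "\<dots> = C * \<kappa> * r powr \<sigma> * (indicator (cball 0 R) x * r powr (\<sigma> - real DIM('a)))"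
        unfolding pow by (simp only: mult_ac)
      also have "\<dots> \<le> C * \<kappa> * t powr \<sigma> * (indicator (cball 0 R) x * r powr (\<sigma> - real DIM('a)))"
        using r \<sigma> C \<kappa> by (intro mult_right_mono mult_left_mono powr_mono2) auto
      finally have "ennreal ((g y - g x)\<^sup>2 * J_xi \<kappa> \<beta> J t x y) \<le>
          ennreal (C * \<kappa> * t powr \<sigma> * (indicator (cball 0 R) x * r powr (\<sigma> - real DIM('a))))"
        by (rule ennreal_leI)
      also have "\<dots> = \<psi> z"
        using r C \<kappa> by (simp add: \<psi>_def \<phi>_def ennreal_mult ennreal_indicator[symmetric] r_def x_def y_def)
      finally show ?thesis by (simp add: x_def y_def add_increasing)
    qed
    have \<psi>_int: "(\<integral>\<^sup>+ z. \<psi> z \<partial>lebesgue) = ennreal (C * \<kappa> * I * t powr \<sigma>)"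
    proof -
      have [measurable]: "cball (0::'a) R \<in> sets borel" by simp
      have "(\<lambda>z. indicator (cball 0 R) (fst z) * \<phi> (snd z - fst z)) \<in>
          borel_measurable (lborel \<Otimes>\<^sub>M (lborel :: 'a measure))"
        by measurable
      then have m: "(\<lambda>z. indicator (cball 0 R) (fst z) * \<phi> (snd z - fst z)) \<in>
          borel_measurable (lborel :: ('a \<times> 'a) measure)"
        by (simp add: lborel_prod)
      have "(\<integral>\<^sup>+ z. \<psi> z \<partial>lebesgue) = (\<integral>\<^sup>+ z. \<psi> z \<partial>lborel)" by (rule nn_integral_completion)
      also have "\<dots> = ennreal (C * \<kappa> * t powr \<sigma>) *
          (\<integral>\<^sup>+ z. indicator (cball 0 R) (fst z) * \<phi> (snd z - fst z) \<partial>lborel)"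
        unfolding \<psi>_def by (rule nn_integral_cmult[OF m])
      also have "\<dots> = ennreal (C * \<kappa> * t powr \<sigma>) * ennreal I"
        by (simp add: nn_integral_product_shift I)
      also have "\<dots> = ennreal (C * \<kappa> * I * t powr \<sigma>)"
        using C \<kappa> I by (simp add: ennreal_mult[symmetric] mult_ac)
      finally show ?thesis .
    qed
    have \<psi>_m: "\<psi> \<in> borel_measurable lebesgue"
    proof -
      have [measurable]: "cball (0::'a) R \<in> sets borel" by simp
      have "\<psi> \<in> borel_measurable (lborel \<Otimes>\<^sub>M (lborel :: 'a measure))"
        unfolding \<psi>_def by measurable
      then show ?thesis by (intro measurable_completion) (simp add: lborel_prod)
    qed
    have J_m: "(\<lambda>z. ennreal ((g (snd z) - g (fst z))\<^sup>2 * J (fst z) (snd z))) \<in> borel_measurable lebesgue"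
    proof -
      note [measurable] = increment_measurable[OF \<open>g \<in> borel_measurable lebesgue\<close>] kernel_measurable
      have "(\<lambda>z. ennreal ((increment g z)\<^sup>2 * J (fst z) (snd z))) \<in> borel_measurable lebesgue"
        by measurable
      then show ?thesis by (simp add: increment_def)
    qed
    have "form (J_xi \<kappa> \<beta> J t) g \<le>
        (\<integral>\<^sup>+ z. ennreal ((g (snd z) - g (fst z))\<^sup>2 * J (fst z) (snd z)) + \<psi> z \<partial>lebesgue)"
      unfolding form_def by (rule nn_integral_mono) (rule pointwise)
    also have "\<dots> = form J g + ennreal (C * \<kappa> * I * t powr \<sigma>)"
      unfolding form_def by (subst nn_integral_add[OF J_m \<psi>_m]) (simp only: \<psi>_int)
    finally show ?thesis .
  qed
  moreover have "0 \<le> C * \<kappa> * I" using C \<kappa> I by simp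
  ultimately show thesis using that[of "C * \<kappa> * I"] by (simp add: \<sigma>_def)
qed

section \<open>Mosco convergence\<close>

text \<open>Diagonal selection: if each property \<open>P k\<close> holds eventually, then \<open>k\<close> may be allowed to
  grow with \<open>n\<close>, slowly enough that \<open>P (k n) n\<close> still holds eventually.\<close>

lemma diagonal_index:
  assumes "\<And>k::nat. \<forall>\<^sub>F n in sequentially. P k n"
  obtains k :: "nat \<Rightarrow> nat"
  where "filterlim k at_top sequentially" "\<forall>\<^sub>F n in sequentially. P (k n) n"
proof -
  obtain N where N: "\<And>k n. N k \<le> n \<Longrightarrow> P k n"
    using assms unfolding eventually_sequentially by metis
  define S where "S n = {k. k \<le> n \<and> N k \<le> n}" for n
  define k where "k n = Max (S n)" for n
  have fin: "finite (S n)" for n by (rule finite_subset[of _ "{..n}"]) (auto simp: S_def)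
  have "filterlim k at_top sequentially"
    unfolding filterlim_at_top
  proof
    fix K
    show "\<forall>\<^sub>F n in sequentially. K \<le> k n"
      using eventually_ge_at_top[of "max K (N K)"]
    proof eventually_elim
      case (elim n)
      then have "K \<in> S n" by (simp add: S_def)
      then show ?case unfolding k_def by (rule Max_ge[OF fin])
    qed
  qed
  moreover have "\<forall>\<^sub>F n in sequentially. P (k n) n"
    using eventually_ge_at_top[of "N 0"]
  proof eventually_elim
    case (elim n)
    then have "0 \<in> S n" by (simp add: S_def)
    then have "k n \<in> S n" unfolding k_def using fin by (intro Max_in) auto
    then show ?case by (intro N) (simp add: S_def)
  qed
  ultimately show thesis by (rule that)
qed

theorem theorem1p5:
  fixes J :: "'a::euclidean_space \<Rightarrow> 'a \<Rightarrow> real"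
    and \<alpha> \<beta> \<kappa>\<^sub>1 \<kappa>\<^sub>2 :: real and \<xi> :: "nat \<Rightarrow> real"
  assumes J_measurable: "(\<lambda>z. J (fst z) (snd z)) \<in> borel_measurable lebesgue"
    and J_nonneg: "\<And>x y. 0 \<le> J x y"
    and A1: "\<And>x y. J x y = J y x"
    and A2: "\<And>x y. norm (x - y) \<ge> 1 \<Longrightarrow> J x y = 0"
    and A3_consts: "0 < \<alpha>" "\<alpha> < \<beta>" "\<beta> < 2" "0 < \<kappa>\<^sub>1" "0 < \<kappa>\<^sub>2"
    and A3: "\<And>x y. 0 < norm (x - y) \<Longrightarrow> norm (x - y) < 1 \<Longrightarrow>
        \<kappa>\<^sub>1 * norm (y - x) powr (- real DIM('a) - \<alpha>) \<le> J x y \<and>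
        J x y \<le> \<kappa>\<^sub>2 * norm (y - x) powr (- real DIM('a) - \<beta>)"
    and xi_pos: "\<And>n. 0 < \<xi> n"
    and xi_lim: "\<xi> \<longlonglongrightarrow> 0"
  shows "mosco_converges
           (\<lambda>n. form (J_xi \<kappa>\<^sub>2 \<beta> J (\<xi> n))) (\<lambda>n. form_domain (J_xi \<kappa>\<^sub>2 \<beta> J (\<xi> n)))
           (form J) (form_domain J)"
proof -
  interpret jump_kernel J using J_measurable J_nonneg by unfold_locales
  let ?J = "\<lambda>n. J_xi \<kappa>\<^sub>2 \<beta> J (\<xi> n)"
  have le: "J x y \<le> J_xi \<kappa>\<^sub>2 \<beta> J t x y" if "x \<noteq> y" for x y t
  proof (cases "norm (x - y) < 1")
    case True
    then have "J x y \<le> \<kappa>\<^sub>2 * norm (y - x) powr (- real DIM('a) - \<beta>)"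
      using A3[of x y] that by simp
    then show ?thesis unfolding J_xi_def by (simp only: norm_minus_commute[of y x]) simp
  next
    case False
    then have "J x y = 0" by (intro A2) simp
    then show ?thesis unfolding J_xi_def using A3_consts(5) by simp
  qed
  show ?thesis
    unfolding mosco_converges_def
  proof (intro conjI allI impI ballI)
    fix us :: "nat \<Rightarrow> 'a \<Rightarrow> real" and u
    assume weak: "L2_weak_conv us u"
    let ?E = "\<lambda>n. extended_form (form (?J n)) (form_domain (?J n)) (us n)"
    show "extended_form (form J) (form_domain J) u \<le> liminf ?E"
    proof (rule ccontr)
      assume "\<not> ?thesis"
      then have "liminf ?E < extended_form (form J) (form_domain J) u" by (simp only: not_le)
      then obtain c where c: "liminf ?E < c" "c < extended_form (form J) (form_domain J) u"
        using dense by blast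
      have "\<exists>\<^sub>F n in sequentially. ?E n < c"
      proof (rule ccontr)
        assume "\<not> ?thesis"
        then have "\<forall>\<^sub>F n in sequentially. c \<le> ?E n"
          by (simp add: not_frequently not_less)
        then have "c \<le> liminf ?E" by (rule Liminf_bounded)
        with c(1) show False by simp
      qed
      then have "\<exists>\<^sub>F n in sequentially. us n \<in> form_domain J \<and> form J (us n) \<le> c"
      proof (rule frequently_elim1)
        fix n assume n: "?E n < c"
        then have dom: "us n \<in> form_domain (?J n)" and "form (?J n) (us n) < c"
          by (auto simp: extended_form_def split: if_splits)
        moreover have "form J (us n) \<le> form (?J n) (us n)" by (intro form_mono le)
        moreover have "form_domain (?J n) \<subseteq> form_domain J" by (intro form_domain_antimono le)
        then have "us n \<in> form_domain J" using dom by (rule subsetD)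
        ultimately show "us n \<in> form_domain J \<and> form J (us n) \<le> c"
          by (meson less_imp_le order_trans)
      qed
      moreover have "c < \<infinity>" using c(2) by (rule less_le_trans) simp
      ultimately have "u \<in> form_domain J" "form J u \<le> c"
        using form_weakly_lower_semicontinuous[OF weak] by blast+
      with c(2) show False by (simp add: extended_form_def)
    qed
  next
    fix u :: "'a \<Rightarrow> real"
    assume u: "u \<in> L2"
    let ?E = "\<lambda>us n. extended_form (form (?J n)) (form_domain (?J n)) (us n)"
    show "\<exists>us. L2_strong_conv us u \<and> limsup (?E us) \<le> extended_form (form J) (form_domain J) u"
    proof (cases "u \<in> form_domain J \<and> form J u < \<infinity>")
      case False
      then have "extended_form (form J) (form_domain J) u = \<infinity>"
        by (auto simp: extended_form_def less_top[symmetric])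
      moreover have "L2_strong_conv (\<lambda>n. u) u" using u by (simp add: L2_strong_conv_def)
      ultimately show ?thesis by (intro exI[of _ "\<lambda>n. u"]) simp
    next
      case True
      then have dom: "u \<in> form_domain J" and fin: "form J u < \<infinity>" by auto
      have "\<exists>h. h \<in> C1_compact_support \<and> form J h \<le> form J u + ennreal (1 / real (Suc k)) \<and>
          (\<integral>x. (h x - u x)\<^sup>2 \<partial>lebesgue) < 1 / real (Suc k)" for k
        using core_approximation[OF dom fin, of "1 / real (Suc k)"] by fastforce
      then obtain h where h: "\<And>k. h k \<in> C1_compact_support"
        and h_form: "\<And>k. form J (h k) \<le> form J u + ennreal (1 / real (Suc k))"
        and h_near: "\<And>k. (\<integral>x. (h k x - u x)\<^sup>2 \<partial>lebesgue) < 1 / real (Suc k)"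
        by metis
      have "\<forall>\<^sub>F n in sequentially. form (?J n) (h k) \<le> form J u + ennreal (2 / real (Suc k))" for k
      proof -
        obtain K where "0 \<le> K" and K: "\<And>t. 0 < t \<Longrightarrow> t \<le> 1 \<Longrightarrow>
            form (J_xi \<kappa>\<^sub>2 \<beta> J t) (h k) \<le> form J (h k) + ennreal (K * t powr ((2 - \<beta>) / 2))"
          using form_J_xi_le[OF h[of k] A3_consts(3,5)] by metis
        have "(\<lambda>n. \<xi> n powr ((2 - \<beta>) / 2)) \<longlonglongrightarrow> 0"
          by (rule tendsto_zero_powrI[OF xi_lim tendsto_const])
            (use less_imp_le[OF xi_pos] A3_consts in auto)
        then have "(\<lambda>n. K * \<xi> n powr ((2 - \<beta>) / 2)) \<longlonglongrightarrow> 0" by (rule tendsto_mult_right_zero)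
        then have "\<forall>\<^sub>F n in sequentially. K * \<xi> n powr ((2 - \<beta>) / 2) < 1 / real (Suc k)"
          by (rule order_tendstoD(2)) simp
        moreover have "\<forall>\<^sub>F n in sequentially. \<xi> n < 1"
          using xi_lim by (rule order_tendstoD(2)) simp
        ultimately show ?thesis
        proof eventually_elim
          case (elim n)
          have "form (?J n) (h k) \<le> form J (h k) + ennreal (K * \<xi> n powr ((2 - \<beta>) / 2))"
            using K[OF xi_pos] elim by simp
          also have "\<dots> \<le> (form J u + ennreal (1 / real (Suc k))) + ennreal (1 / real (Suc k))"
            using elim by (intro add_mono h_form ennreal_leI) simp
          also have "\<dots> = form J u + ennreal (1 / real (Suc k) + 1 / real (Suc k))"
            by (subst ennreal_plus) (auto simp: add.assoc)
          finally show ?case by simp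
        qed
      qed
      then obtain k where k: "filterlim k at_top sequentially"
        and k_form: "\<forall>\<^sub>F n in sequentially.
          form (?J n) (h (k n)) \<le> form J u + ennreal (2 / real (Suc (k n)))"
        by (rule diagonal_index)
      have inv: "(\<lambda>n. 1 / real (Suc (k n))) \<longlonglongrightarrow> 0"
        by (rule filterlim_compose[OF LIMSEQ_Suc[OF lim_1_over_n] k])
      have "(\<lambda>n. \<integral>x. (h (k n) x - u x)\<^sup>2 \<partial>lebesgue) \<longlonglongrightarrow> 0"
        by (rule tendsto_sandwich[OF _ _ tendsto_const inv])
          (use less_imp_le[OF h_near] in auto)
      then have strong: "L2_strong_conv (\<lambda>n. h (k n)) u"
        using u h by (auto simp: L2_strong_conv_def intro: C1_compact_support_imp_L2)
      have "limsup (?E (\<lambda>n. h (k n))) \<le> limsup (\<lambda>n. form J u + ennreal (2 / real (Suc (k n))))"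
      proof (rule Limsup_mono)
        show "\<forall>\<^sub>F n in sequentially. ?E (\<lambda>n. h (k n)) n \<le> form J u + ennreal (2 / real (Suc (k n)))"
          using k_form by (simp add: extended_form_def C1_compact_support_imp_form_domain[OF h])
      qed
      also have "\<dots> = form J u"
      proof (rule lim_imp_Limsup)
        have "(\<lambda>n. ennreal (2 * (1 / real (Suc (k n))))) \<longlonglongrightarrow> ennreal (2 * 0)"
          by (intro tendsto_ennrealI tendsto_mult tendsto_const inv)
        then have "(\<lambda>n. form J u + ennreal (2 / real (Suc (k n)))) \<longlonglongrightarrow> form J u + 0"
          by (intro tendsto_add tendsto_const) simp
        then show "(\<lambda>n. form J u + ennreal (2 / real (Suc (k n)))) \<longlonglongrightarrow> form J u" by simp
      qed simp
      also have "\<dots> = extended_form (form J) (form_domain J) u" using dom by (simp add: extended_form_def)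
      finally show ?thesis using strong by blast
    qed
  qed
qed

end
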